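(* Let $d\ge1$ be an integer, $\varepsilon\in(0,1)$, $\beta\ge1$, $1\le p<\infty$, and let $C_1>0$ be a constant, depending only on $d,p,\beta$ (and $\varepsilon$), such that for all $e\in\mathbb{S}^d$, $\alpha\in(0,\pi-\varepsilon]$, positive integers $n$, $\delta\in(0,1]$, all $(\delta/n,\rho)$-separable subsets $\Lambda$ of $B(e,\alpha)$ and all $f\in\Pi_n^d$, $$\sum_{\omega\in\Lambda}\Bigl(\max_{x,y\in B_\rho(\omega,\beta\delta/n)}|f(x)-f(y)|^p\Bigr)|B_\rho(\omega,\delta/n)|\le(C_1\delta)^p\int_{B(e,\alpha)}|f(x)|^p\,d\sigma(x).$$ Let $e\in\mathbb{S}^d$, $\alpha\in(0,\pi-\varepsilon]$, let $n$ be a positive integer, let $\delta\in(0,1]$ with $\delta\le\frac{1}{4C_1}$, and let $\Lambda$ be a maximal $(\delta/n,\rho)$-separable subset of $B(e,\alpha)$. Then for all $f\in\Pi_n^d$, $$\int_{B(e,\alpha)}|f(x)|^p\,d\sigma(x)\sim\sum_{\omega\in\Lambda}\Bigl(\max_{x\in B_\rho(\omega,\beta\delta/n)}|f(x)|^p\Bigr)\triangle_{\delta/n}(\omega)\sim\sum_{\omega\in\Lambda}\Bigl(\min_{x\in B_\rho(\omega,\beta\delta/n)}|f(x)|^p\Bigr)\triangle_{\delta/n}(\omega),$$ where the constants of equivalence are independent of $f$, $n$, $\alpha$ and $\Lambda$.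
   Context: $\mathbb{S}^d$ is the unit sphere of $\mathbb{R}^{d+1}$ with the usual rotation invariant (Lebesgue surface) measure $d\sigma$; $|E|$ denotes the $\sigma$-measure of $E\subset\mathbb{S}^d$. $d(x,y)=\arccos (x\cdot y)$ is the geodesic distance, and $B(e,\alpha)=\{x\in\mathbb{S}^d: d(x,e)\le\alpha\}$. $\Pi_n^d$ is the space of spherical polynomials of degree at most $n$, i.e. restrictions to $\mathbb{S}^d$ of polynomials in $d+1$ variables of total degree at most $n$. For $x,y\in B(e,\alpha)$ put $b_x=\alpha-d(x,e)$ and $$\rho(x,y)=\frac1\alpha\sqrt{(d(x,y))^2+\alpha\bigl(b_x^{1/2}-b_y^{1/2}\bigr)^2},$$ which is a metric on $B(e,\alpha)$; $B_\rho(x,r)=\{y\in B(e,\alpha):\rho(x,y)\le r\}$. For $r>0$, $x\in B(e,\alpha)$, $$\triangle_r(x)=\alpha^d\Bigl(r^{d+1}+r^d\sqrt{1-\tfrac{d(x,e)}{\alpha}}\Bigr).$$ A finite subset $A\subset B(e,\alpha)$ is $(s,\rho)$-separable if $\rho(\xi,\xi')\ge s$ for all distinct $\xi,\xi'\in A$; it is maximal $(s,\rho)$-separable if in addition $B(e,\alpha)=\bigcup_{\xi\in A}B_\rho(\xi,s)$. $A\sim B$ means $C^{-1}B\le A\le CB$ for a constant $C>0$ (constant of equivalence). A constant $C_1$ with the property required in the claim exists. *)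

theory Defs
  imports "HOL-Analysis.Analysis"
begin

text \<open>
  The ambient space \<open>\<real>\<^sup>d\<^sup>+\<^sup>1\<close> is \<open>real ^ 'n\<close> with \<open>CARD('n) = d + 1\<close>; the sphere
  \<open>\<S>\<^sup>d\<close> is \<open>sphere 0 1\<close>.
\<close>

text \<open>
  The surface measure is obtained from polar coordinates: the measure of \<open>E \<subseteq> \<S>\<^sup>d\<close> is \<open>d + 1\<close>
  times the Lebesgue measure of the cone \<open>{t x | 0 < t < 1, x \<in> E}\<close>, that is, of the part of
  the punctured unit ball that radial projection maps into \<open>E\<close>.  The underlying space of the
  measure is the sphere, with its Borel sets.
\<close>

definition sphere_measure :: "(real ^ 'n) measure" where
  "sphere_measure =
     scale_measure (of_nat CARD('n))
       (distr (restrict_space lborel (ball 0 1 - {0}))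
              (restrict_space borel (sphere 0 1))
              (\<lambda>x. x /\<^sub>R norm x))"

definition geodist :: "real ^ 'n \<Rightarrow> real ^ 'n \<Rightarrow> real" where
  "geodist x y = arccos (x \<bullet> y)"

definition cap :: "real ^ 'n \<Rightarrow> real \<Rightarrow> (real ^ 'n) set" where
  "cap e \<alpha> = {x \<in> sphere 0 1. geodist x e \<le> \<alpha>}"

text \<open>
  Elements of \<open>\<Pi>\<^sub>n\<^sup>d\<close> are represented by functions on the whole space, of which only the values
  on the sphere are constrained.  A multi-index is a function \<open>'n \<Rightarrow> nat\<close>.
\<close>

definition spherical_polys :: "nat \<Rightarrow> (real ^ 'n \<Rightarrow> real) set" where
  "spherical_polys n =
     {f. \<exists>c :: ('n \<Rightarrow> nat) \<Rightarrow> real. \<forall>x \<in> sphere 0 1.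
           f x = (\<Sum>k | (\<Sum>i\<in>UNIV. k i) \<le> n. c k * (\<Prod>i\<in>UNIV. (x $ i) ^ k i))}"

definition bdist :: "real ^ 'n \<Rightarrow> real \<Rightarrow> real ^ 'n \<Rightarrow> real" where
  "bdist e \<alpha> x = \<alpha> - geodist x e"

definition cap_rho :: "real ^ 'n \<Rightarrow> real \<Rightarrow> real ^ 'n \<Rightarrow> real ^ 'n \<Rightarrow> real" where
  "cap_rho e \<alpha> x y =
     1 / \<alpha> * sqrt ((geodist x y)\<^sup>2 + \<alpha> * (sqrt (bdist e \<alpha> x) - sqrt (bdist e \<alpha> y))\<^sup>2)"

definition rho_ball :: "real ^ 'n \<Rightarrow> real \<Rightarrow> real ^ 'n \<Rightarrow> real \<Rightarrow> (real ^ 'n) set" where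
  "rho_ball e \<alpha> x r = {y \<in> cap e \<alpha>. cap_rho e \<alpha> x y \<le> r}"

definition tri :: "nat \<Rightarrow> real ^ 'n \<Rightarrow> real \<Rightarrow> real \<Rightarrow> real ^ 'n \<Rightarrow> real" where
  "tri d e \<alpha> r x = \<alpha> ^ d * (r ^ (d + 1) + r ^ d * sqrt (1 - geodist x e / \<alpha>))"

definition rho_separable :: "real ^ 'n \<Rightarrow> real \<Rightarrow> real \<Rightarrow> (real ^ 'n) set \<Rightarrow> bool" where
  "rho_separable e \<alpha> s A \<longleftrightarrow>
     finite A \<and> A \<subseteq> cap e \<alpha> \<and> (\<forall>\<xi>\<in>A. \<forall>\<xi>'\<in>A. \<xi> \<noteq> \<xi>' \<longrightarrow> s \<le> cap_rho e \<alpha> \<xi> \<xi>')"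

definition maximal_rho_separable :: "real ^ 'n \<Rightarrow> real \<Rightarrow> real \<Rightarrow> (real ^ 'n) set \<Rightarrow> bool" where
  "maximal_rho_separable e \<alpha> s A \<longleftrightarrow>
     rho_separable e \<alpha> s A \<and> cap e \<alpha> = (\<Union>\<xi>\<in>A. rho_ball e \<alpha> \<xi> s)"

text \<open>
  The suprema and infima below are maxima and minima: \<open>f\<close> is continuous on the sphere and the
  balls are compact, and nonempty when \<open>\<omega>\<close> lies in the cap and \<open>r \<ge> 0\<close>.
\<close>

definition max_osc ::
  "real ^ 'n \<Rightarrow> real \<Rightarrow> real \<Rightarrow> (real ^ 'n \<Rightarrow> real) \<Rightarrow> real ^ 'n \<Rightarrow> real \<Rightarrow> real" where
  "max_osc e \<alpha> p f \<omega> r =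
     (SUP (x, y) \<in> rho_ball e \<alpha> \<omega> r \<times> rho_ball e \<alpha> \<omega> r. \<bar>f x - f y\<bar> powr p)"

definition max_pow ::
  "real ^ 'n \<Rightarrow> real \<Rightarrow> real \<Rightarrow> (real ^ 'n \<Rightarrow> real) \<Rightarrow> real ^ 'n \<Rightarrow> real \<Rightarrow> real" where
  "max_pow e \<alpha> p f \<omega> r = (SUP x \<in> rho_ball e \<alpha> \<omega> r. \<bar>f x\<bar> powr p)"

definition min_pow ::
  "real ^ 'n \<Rightarrow> real \<Rightarrow> real \<Rightarrow> (real ^ 'n \<Rightarrow> real) \<Rightarrow> real ^ 'n \<Rightarrow> real \<Rightarrow> real" where
  "min_pow e \<alpha> p f \<omega> r = (INF x \<in> rho_ball e \<alpha> \<omega> r. \<bar>f x\<bar> powr p)"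

definition cap_integral ::
  "real ^ 'n \<Rightarrow> real \<Rightarrow> real \<Rightarrow> (real ^ 'n \<Rightarrow> real) \<Rightarrow> real" where
  "cap_integral e \<alpha> p f = (LINT x:cap e \<alpha>|sphere_measure. \<bar>f x\<bar> powr p)"

definition equiv_with :: "real \<Rightarrow> real \<Rightarrow> real \<Rightarrow> bool" where
  "equiv_with C A B \<longleftrightarrow> inverse C * B \<le> A \<and> A \<le> C * B"

end

theory Submission
  imports Defs
begin

text \<open>
  Write \<open>s = \<delta> / n\<close>.  The theorem follows from two facts.

  The first is geometric: the measure of \<open>B\<^sub>\<rho>(x, s)\<close> is comparable to \<open>\<triangle>\<^sub>s(x)\<close>, uniformly in \<open>x\<close>,
  \<open>s \<le> 1\<close> and \<open>\<alpha> \<le> \<pi> - \<epsilon>\<close> (lemma \<open>measure_rho_ball\<close>).  Such a ball is roughly the intersection of the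
  geodesic ball of radius \<open>R = \<alpha> s\<close> around \<open>x\<close> with an annulus around \<open>e\<close> of thickness
  \<open>R (s + t)\<close>, where \<open>t\<^sup>2 = 1 - d(x, e) / \<alpha>\<close>.  As the surface measure is defined through cones, it
  suffices to enclose the cone over the ball in a rectangular box, and to find a box in it.  One
  edge of the boxes points along \<open>x\<close>, another along the unit tangent \<open>u\<close> at \<open>x\<close> in the direction
  of \<open>e\<close>, and the latter has length of order \<open>R (s + t)\<close>.  In the outer half of the
  cap the boundary of the annulus is curved, but over the width of the ball this moves it away
  from a hyperplane orthogonal to \<open>u\<close> by \<open>O(R\<^sup>2 / \<alpha>) = O(R s)\<close> only.  In the inner half \<open>t\<close> is
  bounded below, and the ball is comparable to a geodesic ball.

  The second is the absorption of oscillation.  The maximum of \<open>\<bar>f\<bar>\<^sup>p\<close> over a ball is at most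
  \<open>2\<^sup>p\<^sup>-\<^sup>1\<close> times the sum of the minimum and the oscillation.  The assumed inequality bounds the
  total oscillation by \<open>(C\<^sub>1 \<delta>)\<^sup>p \<le> 4\<^sup>-\<^sup>p\<close> times the integral of \<open>\<bar>f\<bar>\<^sup>p\<close>, and that integral is at most
  the sum of the maxima because the balls cover the cap.  Hence the oscillation accounts for
  at most a quarter of the sum of the maxima, which is therefore bounded by the sum of the minima.
  Conversely, the minima over the balls of radius \<open>\<beta> s\<close> bound \<open>\<bar>f\<bar>\<^sup>p\<close> from below on the disjoint balls of
  radius \<open>s / 3\<close>, so their sum is bounded by the integral (lemma \<open>marcinkiewicz_zygmund\<close>).
\<close>

section \<open>Geodesic distance and the metric of the cap\<close>

text \<open>
  By concavity on \<open>[0, \<pi>]\<close>.  With \<open>c = \<pi> / 2\<close> this is Jordan's inequality; with \<open>c = \<pi> - \<epsilon>\<close> it shows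
  that \<open>sin v\<close> is comparable to \<open>v\<close> on all caps of radius at most \<open>\<pi> - \<epsilon>\<close>, the only place where
  staying away from the antipode matters.
\<close>

lemma sin_ge_chord:
  fixes v c :: real
  assumes "0 \<le> v" "v \<le> c" "0 < c" "c \<le> pi"
  shows "v / c * sin c \<le> sin v"
proof -
  have "concave_on {0..pi} sin"
    by (rule f''_le0_imp_concave[where f' = cos and f'' = "\<lambda>x. - sin x"])
       (auto intro!: derivative_eq_intros sin_ge_zero)
  from concave_onD[OF this, of "v / c" 0 c] show ?thesis
    using assms by (simp add: field_simps)
qed

lemma geodist_bounds:
  assumes "norm x = 1" "norm y = 1"
  shows "0 \<le> geodist x y" "geodist x y \<le> pi" "cos (geodist x y) = x \<bullet> y"
proof -
  have "\<bar>x \<bullet> y\<bar> \<le> 1" using Cauchy_Schwarz_ineq2[of x y] assms by simp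
  then show "0 \<le> geodist x y" "geodist x y \<le> pi" "cos (geodist x y) = x \<bullet> y"
    unfolding geodist_def by (auto intro: arccos_lbound arccos_ubound)
qed

lemma geodist_commute: "geodist x y = geodist y x"
  by (simp add: geodist_def inner_commute)

lemma sin_geodist:
  assumes "norm x = 1" "norm y = 1"
  shows "norm (y - (x \<bullet> y) *\<^sub>R x) = sin (geodist x y)"
proof -
  have [simp]: "x \<bullet> x = 1" "y \<bullet> y = 1" using assms by (simp_all add: norm_eq_1)
  have "(norm (y - (x \<bullet> y) *\<^sub>R x))\<^sup>2 = 1 - (x \<bullet> y)\<^sup>2"
    unfolding power2_norm_eq_inner
    by (simp add: inner_diff_left inner_diff_right inner_commute power2_eq_square)
  also have "\<dots> = (sin (geodist x y))\<^sup>2"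
    using geodist_bounds[OF assms] by (simp add: sin_squared_eq)
  finally show ?thesis
    using geodist_bounds[OF assms] by (simp add: sin_ge_zero power2_eq_imp_eq)
qed

text \<open>
  Project \<open>x\<close> and \<open>z\<close> to the hyperplane orthogonal to \<open>y\<close>.  The projections have norms
  \<open>sin d(x,y)\<close> and \<open>sin d(y,z)\<close>, so the Cauchy--Schwarz inequality for them says
  \<open>cos (d(x,y) + d(y,z)) \<le> x \<bullet> z\<close>.
\<close>

lemma geodist_triangle:
  assumes "norm x = 1" "norm y = 1" "norm z = 1"
  shows "geodist x z \<le> geodist x y + geodist y z"
proof (cases "geodist x y + geodist y z \<le> pi")
  case True
  let ?a = "geodist x y" and ?b = "geodist y z"
  let ?p = "x - (y \<bullet> x) *\<^sub>R y" and ?q = "z - (y \<bullet> z) *\<^sub>R y"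
  have yy: "y \<bullet> y = 1" using assms by (simp add: norm_eq_1)
  have "?p \<bullet> ?q = x \<bullet> z - (x \<bullet> y) * (y \<bullet> z)"
    using yy by (simp add: inner_diff_left inner_diff_right inner_commute algebra_simps)
  moreover have "- (?p \<bullet> ?q) \<le> norm ?p * norm ?q"
    using Cauchy_Schwarz_ineq2[of ?p ?q] by linarith
  moreover have "norm ?p = sin ?a" "norm ?q = sin ?b"
    using sin_geodist[of y x] sin_geodist[of y z] assms by (simp_all add: geodist_commute)
  ultimately have "x \<bullet> y * (y \<bullet> z) - sin ?a * sin ?b \<le> x \<bullet> z" by simp
  then have "cos (?a + ?b) \<le> cos (geodist x z)"
    unfolding cos_add geodist_bounds(3)[OF assms(1,2)] geodist_bounds(3)[OF assms(2,3)]
      geodist_bounds(3)[OF assms(1,3)] .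
  then show ?thesis
    using True geodist_bounds assms by (subst (asm) cos_mono_le_eq) auto
next
  case False
  then show ?thesis using geodist_bounds(2)[of x z] assms by linarith
qed

lemma norm_diff_le_geodist:
  assumes "norm x = 1" "norm y = 1"
  shows "norm (y - x) \<le> geodist x y" "1 - x \<bullet> y \<le> (geodist x y)\<^sup>2 / 2"
proof -
  let ?D = "geodist x y"
  have [simp]: "x \<bullet> x = 1" "y \<bullet> y = 1" using assms by (simp_all add: norm_eq_1)
  have "\<bar>sin (?D / 2)\<bar> \<le> \<bar>?D / 2\<bar>" by (rule abs_sin_x_le_abs_x)
  then have "(sin (?D / 2))\<^sup>2 \<le> (?D / 2)\<^sup>2" by (simp only: abs_le_square_iff)
  moreover have "cos ?D = 1 - 2 * (sin (?D / 2))\<^sup>2"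
    using cos_double_sin[of "?D / 2"] by simp
  ultimately show *: "1 - x \<bullet> y \<le> ?D\<^sup>2 / 2"
    using geodist_bounds[OF assms] by (simp add: power_divide)
  have "(norm (y - x))\<^sup>2 = 2 * (1 - x \<bullet> y)"
    by (simp add: power2_norm_eq_inner inner_diff_left inner_diff_right inner_commute)
  with * have "(norm (y - x))\<^sup>2 \<le> ?D\<^sup>2" by simp
  then show "norm (y - x) \<le> ?D"
    using geodist_bounds[OF assms] by (meson power2_le_imp_le)
qed

lemma geodist_le_tangential:
  assumes "norm x = 1" "norm y = 1" "0 \<le> x \<bullet> y"
  shows "geodist x y \<le> 2 * norm (y - (x \<bullet> y) *\<^sub>R x)"
    "1 - x \<bullet> y \<le> (norm (y - (x \<bullet> y) *\<^sub>R x))\<^sup>2"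
proof -
  let ?D = "geodist x y"
  have "?D \<le> pi / 2" 
    using assms norm_cauchy_schwarz[of x y] unfolding geodist_def by (intro arccos_le_pi2) auto
  then have "?D / (pi / 2) * sin (pi / 2) \<le> sin ?D"
    using geodist_bounds[of x y] assms by (intro sin_ge_chord) auto
  moreover have "?D / 2 \<le> ?D / (pi / 2)"
    using geodist_bounds[of x y] assms pi_less_4 by (intro divide_left_mono) auto
  ultimately show "?D \<le> 2 * norm (y - (x \<bullet> y) *\<^sub>R x)"
    using assms by (simp add: sin_geodist)
  have "0 \<le> cos ?D" using assms by (simp add: geodist_bounds(3))
  then have "cos ?D * cos ?D \<le> 1 * cos ?D" by (intro mult_right_mono) auto
  then have "1 - cos ?D \<le> (sin ?D)\<^sup>2"
    using sin_squared_eq[of ?D] by (simp add: power2_eq_square)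
  then show "1 - x \<bullet> y \<le> (norm (y - (x \<bullet> y) *\<^sub>R x))\<^sup>2"
    using assms by (simp add: sin_geodist geodist_bounds)
qed

text \<open>
  Up to the factor \<open>1/\<alpha>\<close>, \<open>\<rho>\<close> is the Euclidean norm of the pair formed by the geodesic distance
  and the difference of the function \<open>\<surd>\<alpha> \<surd>b\<close> at the two points, and both obey a triangle inequality.
\<close>

lemma cap_rho_triangle:
  assumes "0 < \<alpha>" "norm x = 1" "norm y = 1" "norm z = 1"
  shows "cap_rho e \<alpha> x z \<le> cap_rho e \<alpha> x y + cap_rho e \<alpha> y z"
proof -
  define q where "q w = sqrt \<alpha> * sqrt (bdist e \<alpha> w)" for w
  have eq: "cap_rho e \<alpha> v w = norm (geodist v w, q v - q w) / \<alpha>" for v w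
    using assms(1) by (simp add: cap_rho_def q_def norm_Pair power_mult_distrib flip: right_diff_distrib)
  have "norm (geodist x z, q x - q z) \<le> norm (geodist x y + geodist y z, q x - q z)"
    using geodist_triangle[of x y z] geodist_bounds(1)[of x z] assms
    by (auto simp: norm_Pair intro!: power_mono)
  also have "\<dots> = norm ((geodist x y, q x - q y) + (geodist y z, q y - q z))" by simp
  also have "\<dots> \<le> norm (geodist x y, q x - q y) + norm (geodist y z, q y - q z)"
    by (rule norm_triangle_ineq)
  finally show ?thesis
    using assms(1) unfolding eq by (simp add: divide_right_mono flip: add_divide_distrib)
qed

lemma cap_rho_commute: "cap_rho e \<alpha> x y = cap_rho e \<alpha> y x"
  by (simp add: cap_rho_def geodist_commute power2_commute)

lemma cap_rho_self: "norm x = 1 \<Longrightarrow> cap_rho e \<alpha> x x = 0"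
  by (simp add: cap_rho_def geodist_def norm_eq_1)

lemma mem_capD: "x \<in> cap e \<alpha> \<Longrightarrow> norm x = 1" "x \<in> cap e \<alpha> \<Longrightarrow> geodist x e \<le> \<alpha>"
  by (auto simp: cap_def)

section \<open>Rotation invariance of Lebesgue measure over finite index types\<close>

text \<open>
  An index type with a well-order, as it occurs in the change of variables formula for linear maps,
  where matrices are brought into triangular form.  The order on this copy of the finite type \<open>'n\<close>
  comes from an arbitrary injection into the natural numbers, and invariance of Lebesgue measure is
  transported back along the renaming of coordinates.
\<close>

typedef 'n ordered_index = "UNIV :: 'n set"
  by simp

definition index_rank :: "'n::finite ordered_index \<Rightarrow> nat" where
  "index_rank = (SOME r. inj r)"

lemma inj_index_rank: "inj (index_rank :: 'n::finite ordered_index \<Rightarrow> nat)"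
proof -
  obtain r :: "'n \<Rightarrow> nat" where "inj r"
    using finite_imp_inj_to_nat_seg[of "UNIV :: 'n set"] by auto
  moreover have "inj (Rep_ordered_index :: 'n ordered_index \<Rightarrow> 'n)"
    by (simp add: inj_def Rep_ordered_index_inject)
  ultimately have "\<exists>r :: 'n ordered_index \<Rightarrow> nat. inj r"
    using inj_compose by blast
  then show ?thesis unfolding index_rank_def by (rule someI_ex)
qed

instance ordered_index :: (finite) finite
proof
  have "(UNIV :: 'a ordered_index set) = range Abs_ordered_index"
    using type_definition.Abs_image[OF type_definition_ordered_index] by auto
  moreover have "finite (range (Abs_ordered_index :: 'a \<Rightarrow> _))" by (intro finite_imageI) simp
  ultimately show "finite (UNIV :: 'a ordered_index set)" by simp
qed

instantiation ordered_index :: (finite) wellorder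
begin

definition "i \<le> j \<longleftrightarrow> index_rank i \<le> index_rank j"
definition "i < j \<longleftrightarrow> index_rank i < index_rank j"

instance
proof
  fix P :: "'a ordered_index \<Rightarrow> bool" and a
  assume *: "\<And>x. (\<And>y. y < x \<Longrightarrow> P y) \<Longrightarrow> P x"
  show "P a"
  proof (induction a rule: measure_induct_rule[of index_rank])
    case (less x)
    show ?case by (rule *) (simp add: less less_ordered_index_def)
  qed
qed (auto simp: less_eq_ordered_index_def less_ordered_index_def inj_eq[OF inj_index_rank])

end

lemma prod_Basis_cart:
  fixes g :: "real^'n \<Rightarrow> real"
  shows "(\<Prod>b\<in>Basis. g b) = (\<Prod>i\<in>UNIV. g (axis i 1))"
proof -
  have B: "(Basis :: (real^'n) set) = range (\<lambda>i. axis i 1)" by (auto simp: Basis_vec_def)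
  show ?thesis unfolding B by (subst prod.reindex) (auto simp: inj_on_def axis_eq_axis)
qed

definition relabel :: "real^'n \<Rightarrow> real^('n::finite ordered_index)" where
  "relabel v = (\<chi> k. v $ Rep_ordered_index k)"

definition unlabel :: "real^('n::finite ordered_index) \<Rightarrow> real^'n" where
  "unlabel v = (\<chi> k. v $ Abs_ordered_index k)"

lemma relabel_unlabel [simp]: "relabel (unlabel v) = v" "unlabel (relabel w) = w"
  by (simp_all add: relabel_def unlabel_def vec_eq_iff Rep_ordered_index_inverse Abs_ordered_index_inverse)

lemma bij_Abs_ordered_index: "bij (Abs_ordered_index :: 'n \<Rightarrow> 'n ordered_index)"
  using type_definition.Abs_image[OF type_definition_ordered_index]
  by (simp add: bij_def inj_def Abs_ordered_index_inject)

lemma all_ordered_index: "(\<forall>k :: 'n ordered_index. P k) \<longleftrightarrow> (\<forall>i. P (Abs_ordered_index i))"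
proof
  assume *: "\<forall>i. P (Abs_ordered_index i)"
  show "\<forall>k. P k"
  proof
    fix k show "P k" using *[rule_format, of "Rep_ordered_index k"] by (simp add: Rep_ordered_index_inverse)
  qed
qed simp

lemma linear_relabel: "linear relabel" "linear unlabel"
  by (auto intro!: linearI simp: relabel_def unlabel_def vec_eq_iff)

lemma norm_relabel [simp]: "norm (unlabel v) = norm v" "norm (relabel w) = norm w"
proof -
  show *: "norm (unlabel v) = norm v" for v :: "real^('n::finite ordered_index)"
    using sum.reindex_bij_betw[OF bij_Abs_ordered_index, of "\<lambda>k. (v $ k)\<^sup>2"]
    by (simp add: unlabel_def norm_vec_def L2_set_def)
  show "norm (relabel w) = norm w" using *[of "relabel w"] by simp
qed

lemma linear_continuous_on_cart:
  fixes g :: "real^'a \<Rightarrow> real^'b"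
  shows "linear g \<Longrightarrow> continuous_on A g"
  by (rule linear_continuous_on) (rule linear_conv_bounded_linear[THEN iffD1])

text \<open>
  Renaming coordinates maps boxes to boxes of the same volume, and Lebesgue measure is
  determined by its values on boxes.
\<close>

lemma measure_relabel:
  fixes S :: "(real^'n) set"
  assumes "compact S"
  shows "measure lebesgue (relabel ` S) = measure lebesgue S"
proof -
  have [measurable]: "(unlabel :: _ \<Rightarrow> real^'n) \<in> borel \<rightarrow>\<^sub>M borel"
    by (intro borel_measurable_continuous_onI linear_continuous_on_cart linear_relabel)
  have vim: "unlabel -` A = relabel ` A" for A :: "(real^'n) set"
  proof
    show "unlabel -` A \<subseteq> relabel ` A"
    proof
      fix w assume "w \<in> unlabel -` A"
      then have "relabel (unlabel w) \<in> relabel ` A" by blast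
      then show "w \<in> relabel ` A" by simp
    qed
  qed auto
  have "lborel = distr lborel borel (unlabel :: _ \<Rightarrow> real^'n)"
  proof (rule lborel_eqI)
    fix l u :: "real^'n"
    assume *: "\<And>b. b \<in> Basis \<Longrightarrow> l \<bullet> b \<le> u \<bullet> b"
    have le: "l $ i \<le> u $ i" for i
      using *[of "axis i 1"] by (simp add: inner_axis axis_in_Basis_iff)
    have "unlabel -` box l u = box (relabel l) (relabel u)"
      by (simp add: set_eq_iff mem_box_cart unlabel_def relabel_def all_ordered_index Abs_ordered_index_inverse)
    then have "emeasure (distr lborel borel unlabel) (box l u) = emeasure lborel (box (relabel l) (relabel u))"
      by (simp add: emeasure_distr)
    also have "\<dots> = (\<Prod>b\<in>Basis. (relabel u - relabel l) \<bullet> b)"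
      using le by (intro emeasure_lborel_box) (auto simp: Basis_vec_def inner_axis relabel_def)
    also have "\<dots> = (\<Prod>b\<in>Basis. (u - l) \<bullet> b)"
      using prod.reindex_bij_betw[OF bij_Abs_ordered_index, of "\<lambda>k. (relabel u - relabel l) $ k"]
      by (simp add: prod_Basis_cart inner_axis relabel_def Abs_ordered_index_inverse)
    finally show "emeasure (distr lborel borel unlabel) (box l u) = (\<Prod>b\<in>Basis. (u - l) \<bullet> b)" .
  qed simp
  then have "measure lborel S = measure (distr lborel borel (unlabel :: _ \<Rightarrow> real^'n)) S" by simp
  also have "\<dots> = measure lborel (relabel ` S)"
    using assms by (subst measure_distr) (auto simp: vim borel_compact)
  finally have "measure lborel S = measure lborel (relabel ` S)" .
  moreover have "compact (relabel ` S)"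
    by (intro compact_continuous_image linear_continuous_on_cart linear_relabel assms)
  ultimately show ?thesis
    using assms by (simp add: borel_compact)
qed

lemma measure_orthogonal_image_compact:
  fixes T :: "real^'n \<Rightarrow> real^'n"
  assumes T: "orthogonal_transformation T" and S: "compact S"
  shows "measure lebesgue (T ` S) = measure lebesgue S"
proof -
  let ?T = "relabel \<circ> T \<circ> unlabel"
  have TS: "compact (T ` S)" "compact (relabel ` S)"
    by (intro compact_continuous_image linear_continuous_on_cart linear_relabel
          orthogonal_transformation_linear T S)+
  have "orthogonal_transformation ?T"
    using T by (simp add: orthogonal_transformation linear_relabel linear_compose)
  then have "measure lebesgue (?T ` (relabel ` S)) = measure lebesgue (relabel ` S)"
    using TS(2) by (intro measure_orthogonal_image lmeasurable_compact)
  also have "?T ` (relabel ` S) = relabel ` (T ` S)" by (auto simp: image_comp)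
  finally show ?thesis using S TS by (simp add: measure_relabel)
qed

section \<open>Surface measure compared with boxes\<close>

text \<open>
  The reflection in the hyperplane orthogonal to \<open>a - b\<close>.
\<close>

lemma orthogonal_transformation_swap:
  fixes a b :: "'a::euclidean_space"
  assumes "norm a = norm b"
  shows "\<exists>T. orthogonal_transformation T \<and> T a = b \<and> (\<forall>w. w \<bullet> a = 0 \<longrightarrow> w \<bullet> b = 0 \<longrightarrow> T w = w)"
proof (cases "a = b")
  case True
  then show ?thesis by (intro exI[of _ id]) (simp add: orthogonal_transformation_id id_def)
next
  case False
  define v where "v = a - b"
  have nz: "v \<bullet> v \<noteq> 0" using False by (simp add: v_def)
  define T where "T w = w - (2 * (w \<bullet> v) / (v \<bullet> v)) *\<^sub>R v" for w
  have "linear T"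
    by (rule linearI) (simp_all add: T_def inner_add_left algebra_simps add_divide_distrib)
  moreover have "norm (T w) = norm w" for w
    using nz by (simp add: norm_eq T_def inner_diff_left inner_diff_right inner_commute)
  ultimately have "orthogonal_transformation T"
    by (simp add: orthogonal_transformation)
  moreover have "a \<bullet> a = b \<bullet> b" using assms by (simp add: norm_eq)
  then have "2 * (a \<bullet> v) = v \<bullet> v"
    by (simp add: v_def inner_diff_left inner_diff_right inner_commute)
  then have "T a = b" using nz by (simp add: T_def v_def)
  moreover have "T w = w" if "w \<bullet> a = 0" "w \<bullet> b = 0" for w
    using that by (simp add: T_def v_def inner_diff_right)
  ultimately show ?thesis by blast
qed

text \<open>
  Two reflections suffice: the first moves one axis to \<open>x\<close>, and the second moves the image of the
  other axis to \<open>u\<close>, fixing \<open>x\<close> because \<open>x\<close> is orthogonal to both.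
\<close>

lemma orthogonal_transformation_axes:
  fixes x u :: "real ^ 'n" and i j :: 'n
  assumes "norm x = 1" "norm u = 1" "x \<bullet> u = 0" "i \<noteq> j"
  obtains T :: "real^'n \<Rightarrow> real^'n"
  where "orthogonal_transformation T" "T (axis i 1) = x" "T (axis j 1) = u"
proof -
  have "norm (axis i 1 :: real^'n) = norm x" using assms(1) by simp
  then obtain T :: "real^'n \<Rightarrow> real^'n" where T: "orthogonal_transformation T" "T (axis i 1) = x"
    using orthogonal_transformation_swap by blast
  let ?a = "T (axis j 1)"
  have a: "norm ?a = 1" "x \<bullet> ?a = 0"
  proof -
    show "norm ?a = 1" using T(1) by (simp add: orthogonal_transformation_norm)
    have "T (axis i 1) \<bullet> ?a = axis i 1 \<bullet> (axis j 1 :: real^'n)"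
      using T(1) by (simp add: orthogonal_transformation_def)
    then show "x \<bullet> ?a = 0" using assms(4) T(2) by (simp add: inner_axis_axis)
  qed
  obtain S :: "real^'n \<Rightarrow> real^'n" where S: "orthogonal_transformation S" "S ?a = u"
      "\<forall>w. w \<bullet> ?a = 0 \<longrightarrow> w \<bullet> u = 0 \<longrightarrow> S w = w"
    using orthogonal_transformation_swap[of ?a u] a assms(2) by auto
  show ?thesis
  proof (rule that[of "S \<circ> T"])
    show "orthogonal_transformation (S \<circ> T)" by (rule orthogonal_transformation_compose[OF S(1) T(1)])
    show "(S \<circ> T) (axis i 1) = x" using S(3)[rule_format, of x] a(2) assms(3) T(2) by simp
    show "(S \<circ> T) (axis j 1) = u" using S(2) by simp
  qed
qed

lemma space_sphere_measure [simp]: "space (sphere_measure :: (real^'n) measure) = sphere 0 1"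
  by (simp add: sphere_measure_def space_scale_measure space_restrict_space)

lemma sets_sphere_measure [measurable_cong]:
  "sets (sphere_measure :: (real^'n) measure) = sets (restrict_space borel (sphere 0 1))"
  by (simp add: sphere_measure_def)

lemma sets_sphere_measureI:
  "A \<in> sets borel \<Longrightarrow> A \<subseteq> sphere 0 1 \<Longrightarrow> A \<in> sets (sphere_measure :: (real^'n) measure)"
  unfolding sets_sphere_measure by (subst sets_restrict_space_iff) auto

lemma radial_measurable:
  "(\<lambda>x. x /\<^sub>R norm x) \<in>
     restrict_space lborel (ball 0 1 - {0}) \<rightarrow>\<^sub>M restrict_space borel (sphere (0::real^'n) 1)"
  by (intro measurable_restrict_space2 measurable_restrict_space1) (auto simp: space_restrict_space)

definition cone_of :: "(real^'n) set \<Rightarrow> (real^'n) set" where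
  "cone_of A = {z \<in> ball 0 1 - {0}. z /\<^sub>R norm z \<in> A}"

lemma cone_of_measurable:
  assumes "A \<in> sets (sphere_measure :: (real^'n) measure)"
  shows "cone_of A \<in> sets (borel :: (real^'n) measure)" (is ?m)
    and "emeasure sphere_measure A = of_nat CARD('n) * emeasure lborel (cone_of A)" (is ?e)
proof -
  have A: "A \<in> sets (restrict_space borel (sphere (0::real^'n) 1))"
    using assms by (simp add: sets_sphere_measure)
  let ?R = "restrict_space lborel (ball (0::real^'n) 1 - {0})"
  have eq: "(\<lambda>x. x /\<^sub>R norm x) -` A \<inter> space ?R = cone_of A"
    by (auto simp: space_restrict_space cone_of_def)
  have "cone_of A \<in> sets ?R"
    using measurable_sets[OF radial_measurable A] eq by simp
  then show ?m by (subst (asm) sets_restrict_space_iff) auto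
  have "emeasure ?R (cone_of A) = emeasure lborel (cone_of A)"
    by (intro emeasure_restrict_space) (auto simp: cone_of_def)
  then show ?e
    using eq by (simp add: sphere_measure_def emeasure_distr[OF radial_measurable A])
qed

lemma measure_sphere_measure:
  assumes "A \<in> sets (sphere_measure :: (real^'n) measure)"
  shows "cone_of A \<in> lmeasurable"
    and "measure sphere_measure A = CARD('n) * measure lebesgue (cone_of A)"
proof -
  have "cone_of A \<subseteq> ball 0 1" by (auto simp: cone_of_def)
  then show "cone_of A \<in> lmeasurable"
    using cone_of_measurable(1)[OF assms]
    by (intro bounded_set_imp_lmeasurable) (auto intro: bounded_subset)
  show "measure sphere_measure A = CARD('n) * measure lebesgue (cone_of A)"
    using cone_of_measurable[OF assms]
    by (simp add: measure_def enn2real_mult)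
qed

lemma finite_measure_sphere_measure: "finite_measure (sphere_measure :: (real^'n) measure)"
proof
  have "emeasure lborel (cone_of (sphere (0::real^'n) 1)) \<le> emeasure lborel (ball (0::real^'n) 1)"
    by (rule emeasure_mono) (auto simp: cone_of_def)
  also have "\<dots> < \<infinity>" by (rule emeasure_lborel_ball_finite)
  finally show "emeasure (sphere_measure :: (real^'n) measure) (space sphere_measure) \<noteq> \<infinity>"
    using cone_of_measurable(2)[of "sphere 0 1 :: (real^'n) set"]
    by (simp add: ennreal_mult_eq_top_iff sets_sphere_measureI)
qed

lemma ex_two_indices:
  assumes "2 \<le> CARD('n::finite)"
  shows "\<exists>i j :: 'n. i \<noteq> j"
proof (rule ccontr)
  assume "\<not> ?thesis"
  then have "card (UNIV :: 'n set) \<le> Suc 0" by (subst card_le_Suc0_iff_eq) auto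
  with assms show False by simp
qed

text \<open>
  The images of these boxes are boxes with one edge along \<open>T (axis i 1)\<close>, one along
  \<open>T (axis j 1)\<close>, and edges of length \<open>2 b\<close> in the remaining directions.
\<close>

lemma lebesgue_rotated_box:
  fixes T :: "real^'n \<Rightarrow> real^'n"
  assumes "orthogonal_transformation T" "i \<noteq> j" "l1 \<le> r1" "l2 \<le> r2" "0 \<le> b"
  defines "B \<equiv> T ` cbox (\<chi> k. if k = i then l1 else if k = j then l2 else - b)
                  (\<chi> k. if k = i then r1 else if k = j then r2 else b)"
  shows "B \<in> lmeasurable"
    and "measure lebesgue B = (r1 - l1) * (r2 - l2) * (2 * b) ^ (CARD('n) - 2)"
proof -
  let ?p = "(\<chi> k. if k = i then l1 else if k = j then l2 else - b) :: real^'n"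
  let ?q = "(\<chi> k. if k = i then r1 else if k = j then r2 else b) :: real^'n"
  show "B \<in> lmeasurable"
    unfolding B_def by (intro lmeasurable_compact compact_continuous_image linear_continuous_on_cart
        orthogonal_transformation_linear assms(1)) auto
  have "measure lebesgue B = measure lebesgue (cbox ?p ?q)"
    unfolding B_def by (intro measure_orthogonal_image_compact assms(1)) auto
  also have "\<dots> = (\<Prod>k\<in>UNIV. ?q $ k - ?p $ k)"
  proof -
    have "cbox ?p ?q \<noteq> {}"
      unfolding interval_ne_empty_cart using assms(3-5) by simp
    from content_cbox_cart[OF this] show ?thesis
      by (simp only: measure_completion cbox_borel sets_lborel)
  qed
  also have "(UNIV :: 'n set) = insert i (insert j (UNIV - {i, j}))" by auto
  also have "(\<Prod>k\<in>\<dots>. ?q $ k - ?p $ k) = (r1 - l1) * (r2 - l2) * (\<Prod>k\<in>UNIV - {i, j}. 2 * b)"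
    using assms(2) by simp
  finally show "measure lebesgue B = (r1 - l1) * (r2 - l2) * (2 * b) ^ (CARD('n) - 2)"
    using assms(2) by (simp add: card_Diff_subset numeral_2_eq_2)
qed

text \<open>
  The cone over \<open>E\<close> lies in a box with edge \<open>[-1, 1]\<close> along \<open>x\<close>, edge \<open>[-a, a]\<close> along \<open>u\<close> and
  edges \<open>[-b, b]\<close> along an orthonormal basis of the complement, on which \<open>y\<close> and \<open>y - x\<close> have the
  same coordinates.
\<close>

lemma measure_sphere_le_box:
  fixes x u :: "real ^ 'n" and a b :: real
  assumes "norm x = 1" "norm u = 1" "x \<bullet> u = 0" "0 \<le> a" "0 \<le> b" and "2 \<le> CARD('n)"
    and E: "E \<in> sets sphere_measure" "\<And>y. y \<in> E \<Longrightarrow> \<bar>y \<bullet> u\<bar> \<le> a \<and> norm (y - x) \<le> b"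
  shows "measure sphere_measure E \<le> CARD('n) * (4 * a * (2 * b) ^ (CARD('n) - 2))"
proof -
  obtain i j :: 'n where ij: "i \<noteq> j"
    using ex_two_indices[OF assms(6)] by blast
  obtain T :: "real^'n \<Rightarrow> real^'n" where T: "orthogonal_transformation T" "T (axis i 1) = x" "T (axis j 1) = u"
    using orthogonal_transformation_axes[OF assms(1-3) ij] by blast
  let ?B = "cbox (\<chi> k. if k = i then -1 else if k = j then - a else - b)
                  (\<chi> k. if k = i then 1 else if k = j then a else b) :: (real^'n) set"
  have "cone_of E \<subseteq> T ` ?B"
  proof
    fix z assume z: "z \<in> cone_of E"
    define y where "y = z /\<^sub>R norm z"
    have y: "y \<in> E" "z = norm z *\<^sub>R y" "norm z \<le> 1" "norm y = 1"
      using z by (auto simp: cone_of_def y_def)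
    obtain w where w: "z = T w" using T(1) by (metis orthogonal_transformation_surj surjE)
    have coord: "w $ k = norm z * (y \<bullet> T (axis k 1))" for k
    proof -
      have "w $ k = T w \<bullet> T (axis k 1)"
        using T(1) by (simp add: orthogonal_transformation_def inner_axis)
      also have "\<dots> = norm z * (y \<bullet> T (axis k 1))"
        using y(2) w by (metis inner_scaleR_left)
      finally show ?thesis .
    qed
    have unit: "norm (T (axis k 1)) = 1" for k
      using T(1) by (simp add: orthogonal_transformation_norm)
    have le: "\<bar>w $ k\<bar> \<le> \<bar>y \<bullet> T (axis k 1)\<bar>" for k
      using y(3) by (simp add: coord abs_mult mult_left_le_one_le)
    have "\<bar>w $ i\<bar> \<le> 1"
      using le[of i] Cauchy_Schwarz_ineq2[of y "T (axis i 1)"] y(4) unit by simp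
    moreover have "\<bar>w $ j\<bar> \<le> a" using le[of j] E(2)[OF y(1)] T(3) by simp
    moreover have "\<bar>w $ k\<bar> \<le> b" if "k \<noteq> i" for k
    proof -
      have "T (axis i 1) \<bullet> T (axis k 1) = 0"
        using T(1) that by (simp add: orthogonal_transformation_def inner_axis_axis)
      then have "y \<bullet> T (axis k 1) = (y - x) \<bullet> T (axis k 1)"
        using T(2) by (simp add: inner_diff_left)
      then show ?thesis
        using le[of k] Cauchy_Schwarz_ineq2[of "y - x" "T (axis k 1)"] unit E(2)[OF y(1)] by simp
    qed
    ultimately have "w \<in> ?B" by (auto simp: mem_box_cart abs_le_iff minus_le_iff)
    then show "z \<in> T ` ?B" using w by blast
  qed
  then have "measure lebesgue (cone_of E) \<le> measure lebesgue (T ` ?B)"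
    using measure_sphere_measure(1)[OF E(1)] lebesgue_rotated_box(1)[OF T(1) ij] assms(4,5)
    by (intro measure_mono_fmeasurable) auto
  also have "\<dots> = 4 * a * (2 * b) ^ (CARD('n) - 2)"
    using lebesgue_rotated_box(2)[OF T(1) ij, of "-1" 1 "-a" a b] assms(4,5) by simp
  finally show ?thesis
    unfolding measure_sphere_measure(2)[OF E(1)] by (intro mult_left_mono) auto
qed

text \<open>
  Conversely, the cone contains a box as soon as \<open>E\<close> contains its radial projection.  The edge
  along \<open>x\<close> stays away from both \<open>0\<close>, so that radial projection distorts lengths by at most a
  factor \<open>2\<close>, and \<open>1\<close>, so that a thin box stays inside the unit ball.  Along \<open>u\<close> the box
  occupies \<open>[a, 2 a]\<close> and hence lies on one side of the hyperplane orthogonal to \<open>u\<close>, which is needed when \<open>x\<close> is on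
  the boundary of a cap.
\<close>

lemma measure_sphere_ge_box:
  fixes x u :: "real ^ 'n" and a b :: real
  assumes "norm x = 1" "norm u = 1" "x \<bullet> u = 0" "0 \<le> a" "0 \<le> b" and "2 \<le> CARD('n)"
    and E: "E \<in> sets sphere_measure"
      "\<And>z. 1/2 \<le> z \<bullet> x \<Longrightarrow> z \<bullet> x \<le> 3/4 \<Longrightarrow> a \<le> z \<bullet> u \<Longrightarrow> z \<bullet> u \<le> 2 * a \<Longrightarrow>
         norm (z - (z \<bullet> x) *\<^sub>R x) \<le> 2 * a + CARD('n) * b \<Longrightarrow> norm z < 1 \<and> z /\<^sub>R norm z \<in> E"
  shows "CARD('n) * (a / 4 * (2 * b) ^ (CARD('n) - 2)) \<le> measure sphere_measure E"
proof -
  obtain i j :: 'n where ij: "i \<noteq> j"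
    using ex_two_indices[OF assms(6)] by blast
  obtain T :: "real^'n \<Rightarrow> real^'n" where T: "orthogonal_transformation T" "T (axis i 1) = x" "T (axis j 1) = u"
    using orthogonal_transformation_axes[OF assms(1-3) ij] by blast
  let ?B = "cbox (\<chi> k. if k = i then 1/2 else if k = j then a else - b)
                  (\<chi> k. if k = i then 3/4 else if k = j then 2 * a else b) :: (real^'n) set"
  have "T ` ?B \<subseteq> cone_of E"
  proof
    fix z assume "z \<in> T ` ?B"
    then obtain w where w: "z = T w" "w \<in> ?B" by blast
    have bnd: "(if k = i then 1/2 else if k = j then a else - b) \<le> w $ k"
      "w $ k \<le> (if k = i then 3/4 else if k = j then 2 * a else b)" for k
      using w(2) by (auto simp: mem_box_cart)
    have zx: "z \<bullet> x = w $ i" and zu: "z \<bullet> u = w $ j"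
      using T by (auto simp: w orthogonal_transformation_def inner_axis simp flip: T(2,3))
    define v where "v = w - (w $ i) *\<^sub>R axis i 1"
    have v: "v $ k = (if k = i then 0 else w $ k)" for k
      by (simp add: v_def axis_def)
    have "z - (z \<bullet> x) *\<^sub>R x = T v"
      using T(1) by (simp add: v_def w zx[unfolded w] orthogonal_transformation_linear linear_diff linear_scale T(2))
    then have "norm (z - (z \<bullet> x) *\<^sub>R x) = norm v"
      using T(1) by (simp add: orthogonal_transformation_norm)
    also have "\<dots> \<le> (\<Sum>k\<in>UNIV. \<bar>v $ k\<bar>)" by (rule norm_le_l1_cart)
    also have "\<dots> \<le> (\<Sum>k\<in>UNIV. (if k = j then 2 * a else 0) + b)"
    proof (rule sum_mono)
      fix k show "\<bar>v $ k\<bar> \<le> (if k = j then 2 * a else 0) + b"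
        using bnd[of k] assms(4,5) ij by (auto simp: v abs_le_iff)
    qed
    also have "\<dots> = 2 * a + CARD('n) * b" by (simp add: sum.distrib)
    finally have "norm (z - (z \<bullet> x) *\<^sub>R x) \<le> 2 * a + CARD('n) * b" .
    then have "norm z < 1 \<and> z /\<^sub>R norm z \<in> E"
      using bnd[of i] bnd[of j] ij by (intro E(2)) (auto simp: zx zu)
    moreover have "z \<noteq> 0" using bnd(1)[of i] zx by auto
    ultimately show "z \<in> cone_of E" by (simp add: cone_of_def)
  qed
  then have "measure lebesgue (T ` ?B) \<le> measure lebesgue (cone_of E)"
    using measure_sphere_measure(1)[OF E(1)] lebesgue_rotated_box(1)[OF T(1) ij] assms(4,5)
    by (intro measure_mono_fmeasurable) auto
  moreover have "measure lebesgue (T ` ?B) = a / 4 * (2 * b) ^ (CARD('n) - 2)"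
    using lebesgue_rotated_box(2)[OF T(1) ij, of "1/2" "3/4" a "2*a" b] assms(4,5) by simp
  ultimately show ?thesis
    unfolding measure_sphere_measure(2)[OF E(1)] by (intro mult_left_mono) auto
qed

section \<open>Boxes around and inside the balls of the cap metric\<close>

text \<open>
  The Lipschitz constant \<open>c\<close>, instead of \<open>1\<close>, is what makes the estimates below uniform for
  small caps.
\<close>

lemma abs_cos_diff_le:
  fixes a b c :: real
  assumes "0 \<le> a" "a \<le> c" "0 \<le> b" "b \<le> c"
  shows "\<bar>cos a - cos b\<bar> \<le> c * \<bar>a - b\<bar>"
proof -
  have "\<bar>cos a - cos b\<bar> = 2 * (\<bar>sin ((a + b) / 2)\<bar> * \<bar>sin ((b - a) / 2)\<bar>)"
    by (simp add: cos_diff_cos abs_mult)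
  also have "\<dots> \<le> 2 * (\<bar>(a + b) / 2\<bar> * \<bar>(b - a) / 2\<bar>)"
    by (intro mult_left_mono mult_mono abs_sin_x_le_abs_x) auto
  also have "\<dots> = (a + b) / 2 * \<bar>a - b\<bar>" using assms by (simp add: abs_minus_commute)
  also have "\<dots> \<le> c * \<bar>a - b\<bar>" using assms by (intro mult_right_mono) auto
  finally show ?thesis .
qed

text \<open>
  The vector \<open>u\<close> is the unit tangent at \<open>x\<close> pointing to \<open>e\<close>.  At the poles \<open>x = \<plusminus>e\<close> any unit
  tangent serves.
\<close>

lemma meridian_direction:
  fixes x e :: "real^'n"
  assumes "norm x = 1" "norm e = 1" "2 \<le> CARD('n)"
  obtains u where "norm u = 1" "x \<bullet> u = 0" "e = cos (geodist x e) *\<^sub>R x + sin (geodist x e) *\<^sub>R u"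
proof -
  define v where "v = e - (x \<bullet> e) *\<^sub>R x"
  have v: "norm v = sin (geodist x e)" "x \<bullet> v = 0" "e = cos (geodist x e) *\<^sub>R x + v"
    using assms sin_geodist[of x e] geodist_bounds(3)[of x e]
    by (simp_all add: v_def inner_diff_right norm_eq_1)
  show ?thesis
  proof (cases "v = 0")
    case True
    obtain w :: "real^'n" where "w \<noteq> 0" "orthogonal x w"
      using orthogonal_to_vector_exists[of x] assms(3) by auto
    then show ?thesis
      using that[of "w /\<^sub>R norm w"] v True by (simp add: orthogonal_def)
  next
    case False
    then have "norm v *\<^sub>R (v /\<^sub>R norm v) = v" by simp
    then have "e = cos (geodist x e) *\<^sub>R x + sin (geodist x e) *\<^sub>R (v /\<^sub>R norm v)"
      using v(1,3) by metis
    moreover have "x \<bullet> (v /\<^sub>R norm v) = 0" using v(2) by simp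
    moreover have "norm (v /\<^sub>R norm v) = 1" using False by simp
    ultimately show ?thesis using that by blast
  qed
qed

lemma cap_rho_le_iff:
  assumes "0 < \<alpha>" "0 \<le> s"
  shows "cap_rho e \<alpha> x y \<le> s \<longleftrightarrow>
    (geodist x y)\<^sup>2 + (sqrt \<alpha> * (sqrt (bdist e \<alpha> x) - sqrt (bdist e \<alpha> y)))\<^sup>2 \<le> (\<alpha> * s)\<^sup>2"
proof -
  have "cap_rho e \<alpha> x y \<le> s \<longleftrightarrow>
      sqrt ((geodist x y)\<^sup>2 + \<alpha> * (sqrt (bdist e \<alpha> x) - sqrt (bdist e \<alpha> y))\<^sup>2) \<le> \<alpha> * s"
    using assms by (simp add: cap_rho_def pos_divide_le_eq mult.commute)
  also have "\<dots> \<longleftrightarrow> (geodist x y)\<^sup>2 + \<alpha> * (sqrt (bdist e \<alpha> x) - sqrt (bdist e \<alpha> y))\<^sup>2 \<le> (\<alpha> * s)\<^sup>2"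
    using assms by (metis mult_nonneg_nonneg order_less_imp_le real_sqrt_le_iff real_sqrt_unique)
  finally show ?thesis using assms by (simp add: power_mult_distrib)
qed

lemma cap_rho_leD:
  assumes "0 < \<alpha>" "0 \<le> s" "cap_rho e \<alpha> x y \<le> s"
  shows "\<bar>geodist x y\<bar> \<le> \<alpha> * s" "\<bar>sqrt (bdist e \<alpha> x) - sqrt (bdist e \<alpha> y)\<bar> \<le> sqrt \<alpha> * s"
proof -
  let ?q = "sqrt (bdist e \<alpha> x) - sqrt (bdist e \<alpha> y)"
  have le: "(geodist x y)\<^sup>2 + (sqrt \<alpha> * ?q)\<^sup>2 \<le> (\<alpha> * s)\<^sup>2"
    using assms by (simp add: cap_rho_le_iff)
  have "(geodist x y)\<^sup>2 \<le> (\<alpha> * s)\<^sup>2"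
    using le zero_le_power2[of "sqrt \<alpha> * ?q"] by linarith
  then show "\<bar>geodist x y\<bar> \<le> \<alpha> * s" 
    using assms by (metis abs_le_square_iff abs_of_nonneg mult_nonneg_nonneg order_less_imp_le)
  have "(sqrt \<alpha> * ?q)\<^sup>2 \<le> (\<alpha> * s)\<^sup>2"
    using le zero_le_power2[of "geodist x y"] by linarith
  then have "sqrt \<alpha> * \<bar>?q\<bar> \<le> sqrt \<alpha> * (sqrt \<alpha> * s)"
    using assms by (simp add: abs_mult flip: abs_le_square_iff mult.assoc)
  then show "\<bar>?q\<bar> \<le> sqrt \<alpha> * s"
    by (rule mult_left_le_imp_le) (use assms in simp)
qed

lemma cap_rho_leI:
  assumes "0 < \<alpha>" "0 \<le> s" "\<bar>geodist x y\<bar> \<le> \<alpha> * s / 2"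
    "\<bar>sqrt (bdist e \<alpha> x) - sqrt (bdist e \<alpha> y)\<bar> \<le> sqrt \<alpha> * s / 2"
  shows "cap_rho e \<alpha> x y \<le> s"
proof -
  let ?q = "sqrt (bdist e \<alpha> x) - sqrt (bdist e \<alpha> y)"
  have "\<bar>geodist x y\<bar>\<^sup>2 \<le> (\<alpha> * s / 2)\<^sup>2"
    by (rule power_mono[OF assms(3)]) simp
  moreover have "sqrt \<alpha> * \<bar>?q\<bar> \<le> sqrt \<alpha> * (sqrt \<alpha> * s / 2)"
    using assms(1) by (intro mult_left_mono[OF assms(4)]) auto
  then have "\<bar>sqrt \<alpha> * ?q\<bar> \<le> \<alpha> * s / 2"
    using assms(1) by (simp add: abs_mult flip: mult.assoc)
  then have "\<bar>sqrt \<alpha> * ?q\<bar>\<^sup>2 \<le> (\<alpha> * s / 2)\<^sup>2"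
    by (rule power_mono) simp
  moreover have "(\<alpha> * s / 2)\<^sup>2 + (\<alpha> * s / 2)\<^sup>2 \<le> (\<alpha> * s)\<^sup>2"
    by (simp add: power_divide)
  ultimately have "(geodist x y)\<^sup>2 + (sqrt \<alpha> * ?q)\<^sup>2 \<le> (\<alpha> * s)\<^sup>2"
    unfolding power2_abs by linarith
  then show ?thesis using assms by (simp add: cap_rho_le_iff)
qed

text \<open>
  This and the next two lemmas translate closeness of the square roots of the distances to the
  boundary of the cap into closeness of the distances, and back.  Here \<open>\<alpha> t\<^sup>2\<close> is the distance of
  the centre of a \<open>\<rho>\<close>-ball to the boundary, and the factor \<open>2 t + s\<close> shows why \<open>\<rho>\<close>-balls are thin near
  the boundary: their thickness is of order \<open>\<alpha> s (s + t)\<close>.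
\<close>

lemma sqrt_diff_le_imp_diff_le:
  fixes \<alpha> t s b :: real
  assumes "0 < \<alpha>" "0 \<le> t" "0 \<le> s" "0 \<le> b" "\<bar>sqrt \<alpha> * t - sqrt b\<bar> \<le> sqrt \<alpha> * s"
  shows "\<bar>\<alpha> * t\<^sup>2 - b\<bar> \<le> \<alpha> * s * (2 * t + s)"
proof -
  have "\<alpha> * t\<^sup>2 - b = (sqrt \<alpha> * t - sqrt b) * (sqrt \<alpha> * t + sqrt b)"
    using assms by (simp add: algebra_simps power2_eq_square)
  then have "\<bar>\<alpha> * t\<^sup>2 - b\<bar> = \<bar>sqrt \<alpha> * t - sqrt b\<bar> * (sqrt \<alpha> * t + sqrt b)"
    using assms by (simp add: abs_mult)
  also have "\<dots> \<le> (sqrt \<alpha> * s) * (sqrt \<alpha> * (2 * t + s))"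
    using assms by (intro mult_mono) (auto simp: algebra_simps abs_le_iff)
  also have "\<dots> = \<alpha> * s * (2 * t + s)" using assms by simp
  finally show ?thesis .
qed

lemma diff_le_imp_sqrt_diff_le:
  fixes \<alpha> t s b :: real
  assumes "0 < \<alpha>" "0 \<le> t" "0 \<le> s" "\<alpha> * t\<^sup>2 \<le> b" "b \<le> \<alpha> * t\<^sup>2 + \<alpha> * s * (t + s) / 4"
  shows "\<bar>sqrt \<alpha> * t - sqrt b\<bar> \<le> sqrt \<alpha> * s / 2"
proof -
  have "sqrt \<alpha> * t = sqrt (\<alpha> * t\<^sup>2)" using assms by (simp add: real_sqrt_mult)
  then have "sqrt \<alpha> * t \<le> sqrt b" using assms(4) by simp
  moreover have "sqrt b \<le> sqrt \<alpha> * (t + s / 2)"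
  proof -
    have "0 \<le> \<alpha> * (s * t)" using assms by simp
    moreover have "\<alpha> * (t + s / 2)\<^sup>2 = \<alpha> * t\<^sup>2 + \<alpha> * s * (t + s) / 4 + 3 / 4 * (\<alpha> * (s * t))"
      by (simp add: power2_eq_square field_simps)
    ultimately have "b \<le> \<alpha> * (t + s / 2)\<^sup>2"
      using assms(5) by linarith
    then have "sqrt b \<le> sqrt (\<alpha> * (t + s / 2)\<^sup>2)" by simp
    then show ?thesis using assms by (simp add: real_sqrt_mult)
  qed
  ultimately show ?thesis by (simp add: algebra_simps abs_le_iff)
qed

lemma diff_le_imp_sqrt_diff_le_inner:
  fixes \<alpha> a s b :: real
  assumes "0 < \<alpha>" "0 \<le> b" "\<alpha> / 2 \<le> a" "\<bar>a - b\<bar> \<le> \<alpha> * s / 4"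
  shows "\<bar>sqrt a - sqrt b\<bar> \<le> sqrt \<alpha> * s / 2"
proof -
  have "sqrt (\<alpha> / 4) \<le> sqrt a" using assms by (intro real_sqrt_le_mono) linarith
  then have *: "sqrt \<alpha> / 2 \<le> sqrt a + sqrt b" using assms by (simp add: real_sqrt_divide add_increasing2)
  have "\<bar>sqrt a - sqrt b\<bar> * (sqrt \<alpha> / 2) \<le> \<bar>sqrt a - sqrt b\<bar> * (sqrt a + sqrt b)"
    by (intro mult_left_mono *) simp
  also have "\<dots> = \<bar>(sqrt a - sqrt b) * (sqrt a + sqrt b)\<bar>"
    using assms by (simp add: abs_mult)
  also have "(sqrt a - sqrt b) * (sqrt a + sqrt b) = a - b"
    using assms by (simp add: algebra_simps)
  also have "\<bar>a - b\<bar> \<le> (sqrt \<alpha> * s / 2) * (sqrt \<alpha> / 2)"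
  proof -
    have "(sqrt \<alpha> * s / 2) * (sqrt \<alpha> / 2) = (sqrt \<alpha>)\<^sup>2 * s / 4" by (simp add: power2_eq_square)
    then show ?thesis using assms(1,4) by (simp only: real_sqrt_pow2 less_imp_le)
  qed
  finally show ?thesis by (rule mult_right_le_imp_le) (use assms in simp)
qed


text \<open>
  A cap of radius \<open>\<alpha>\<close> on which \<open>sin v \<ge> m v\<close>.  All bounds for its \<open>\<rho>\<close>-balls depend only on \<open>m\<close> and the
  dimension, hence are uniform in \<open>\<alpha> \<le> \<pi> - \<epsilon>\<close>.
\<close>

locale cap_geometry =
  fixes e :: "real^'n" and \<alpha> m :: real
  assumes dim: "2 \<le> CARD('n)" and e: "norm e = 1" and \<alpha>: "0 < \<alpha>" "\<alpha> \<le> pi"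
    and m: "0 < m" "m \<le> 1" and sin_ge: "\<And>v. 0 \<le> v \<Longrightarrow> v \<le> \<alpha> \<Longrightarrow> m * v \<le> sin v"
begin

text \<open>
  The rescaled square root of the distance of \<open>x\<close> to the boundary of the cap.
\<close>

definition edge :: "real^'n \<Rightarrow> real" where
  "edge x = sqrt (1 - geodist x e / \<alpha>)"

lemma edge:
  assumes "x \<in> cap e \<alpha>"
  shows "0 \<le> edge x" "edge x \<le> 1" "\<alpha> * (edge x)\<^sup>2 = \<alpha> - geodist x e" "sqrt (bdist e \<alpha> x) = sqrt \<alpha> * edge x"
proof -
  have *: "0 \<le> geodist x e" "geodist x e \<le> \<alpha>"
    using assms geodist_bounds[of x e] e by (auto simp: cap_def)
  then have "geodist x e / \<alpha> \<le> 1" using \<alpha> by simp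
  then show "0 \<le> edge x" "edge x \<le> 1" "\<alpha> * (edge x)\<^sup>2 = \<alpha> - geodist x e"
    using * \<alpha> by (auto simp: edge_def algebra_simps)
  then show "sqrt (bdist e \<alpha> x) = sqrt \<alpha> * edge x"
    using \<alpha> by (simp add: bdist_def real_sqrt_mult flip: \<open>\<alpha> * (edge x)\<^sup>2 = _\<close>)
qed

lemma tri_eq: "tri d e \<alpha> s x = (\<alpha> * s) ^ d * (s + edge x)"
  by (simp add: tri_def edge_def algebra_simps power_mult_distrib)

lemma rho_ball_geodist:
  assumes "x \<in> cap e \<alpha>" "0 \<le> s" "y \<in> rho_ball e \<alpha> x s"
  shows "geodist x y \<le> \<alpha> * s" "\<bar>geodist x e - geodist y e\<bar> \<le> \<alpha> * s * (2 * edge x + s)"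
proof -
  have y: "y \<in> cap e \<alpha>" "cap_rho e \<alpha> x y \<le> s" using assms by (auto simp: rho_ball_def)
  note le = cap_rho_leD[OF \<alpha>(1) assms(2) y(2)]
  show "geodist x y \<le> \<alpha> * s" using le(1) by simp
  have "\<bar>\<alpha> * (edge x)\<^sup>2 - bdist e \<alpha> y\<bar> \<le> \<alpha> * s * (2 * edge x + s)"
    using le(2) edge[OF assms(1)] edge[OF y(1)] \<alpha> assms(2) mem_capD[OF y(1)]
    by (intro sqrt_diff_le_imp_diff_le) (auto simp: bdist_def)
  then show "\<bar>geodist x e - geodist y e\<bar> \<le> \<alpha> * s * (2 * edge x + s)"
    using edge(3)[OF assms(1)] by (simp add: bdist_def abs_minus_commute)
qed

text \<open>
  Put \<open>R = \<alpha> s\<close>, \<open>t = edge x\<close>, and let \<open>\<theta>\<close> and \<open>\<phi>\<close> be the distances of \<open>x\<close> and \<open>y\<close> to \<open>e\<close>.  If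
  \<open>\<theta> < \<alpha> / 2\<close>, then \<open>t\<close> is bounded below, so \<open>R (s + t)\<close> is of the order of \<open>R\<close> and nothing beyond
  \<open>d(x,y) \<le> R\<close> is required.  Otherwise \<open>sin \<theta>\<close> is of the order of \<open>\<alpha>\<close>, and the identity
  \<open>sin \<theta> (y \<bullet> u) = (cos \<phi> - cos \<theta>) + cos \<theta> (1 - x \<bullet> y)\<close> bounds \<open>y \<bullet> u\<close> by the thickness of the
  annulus \<open>\<bar>\<phi> - \<theta>\<bar> \<le> R (2 t + s)\<close> plus a curvature term of order \<open>R\<^sup>2 / \<alpha> = R s\<close>, which is of no
  larger order.
\<close>

lemma rho_ball_subset_slab:
  assumes x: "x \<in> cap e \<alpha>" and s: "0 < s" "s \<le> 1" and y: "y \<in> rho_ball e \<alpha> x s"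
    and u: "norm u = 1" "x \<bullet> u = 0" "e = cos (geodist x e) *\<^sub>R x + sin (geodist x e) *\<^sub>R u"
  shows "\<bar>y \<bullet> u\<bar> \<le> 4 * (\<alpha> * s) * (s + edge x) / m" "norm (y - x) \<le> \<alpha> * s"
proof -
  define R t \<theta> \<phi> where "R = \<alpha> * s" and "t = edge x" and "\<theta> = geodist x e" and "\<phi> = geodist y e"
  have norms: "norm x = 1" "norm y = 1" "y \<in> cap e \<alpha>"
    using x y by (auto simp: cap_def rho_ball_def)
  have R: "0 < R" "R \<le> \<alpha>" using \<alpha> s by (auto simp: R_def mult_left_le)
  have t: "0 \<le> t" "\<alpha> * t\<^sup>2 = \<alpha> - \<theta>" using edge[OF x] by (auto simp: t_def \<theta>_def)
  have angles: "0 \<le> \<theta>" "\<theta> \<le> \<alpha>" "0 \<le> \<phi>" "\<phi> \<le> \<alpha>"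
    using geodist_bounds[OF norms(1) e] geodist_bounds[OF norms(2) e] mem_capD[OF x] mem_capD[OF norms(3)]
    by (auto simp: \<theta>_def \<phi>_def)
  have D: "geodist x y \<le> R" "\<bar>\<theta> - \<phi>\<bar> \<le> R * (2 * t + s)"
    using rho_ball_geodist[OF x _ y] s by (auto simp: R_def t_def \<theta>_def \<phi>_def)
  have chord: "norm (y - x) \<le> R" using norm_diff_le_geodist(1)[OF norms(1,2)] D(1) by linarith
  then show "norm (y - x) \<le> \<alpha> * s" by (simp add: R_def)
  have "m * \<bar>y \<bullet> u\<bar> \<le> 4 * R * (s + t)"
  proof (cases "\<theta> < \<alpha> / 2")
    case True
    have "1 / 2 \<le> t"
    proof (rule ccontr)
      assume "\<not> 1 / 2 \<le> t"
      then have "t\<^sup>2 \<le> (1 / 2)\<^sup>2" using t(1) by (intro power_mono) auto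
      then have "\<alpha> * t\<^sup>2 \<le> \<alpha> * (1 / 4)" using \<alpha> by (intro mult_left_mono) (auto simp: power2_eq_square)
      then show False using t(2) True \<alpha> by linarith
    qed
    then have "R * 1 \<le> R * (4 * (s + t))" using R s by (intro mult_left_mono) auto
    moreover have "\<bar>(y - x) \<bullet> u\<bar> \<le> R"
      using Cauchy_Schwarz_ineq2[of "y - x" u] u(1) chord by simp
    then have "\<bar>y \<bullet> u\<bar> \<le> R" using u(2) by (simp add: inner_diff_left)
    moreover have "m * \<bar>y \<bullet> u\<bar> \<le> 1 * \<bar>y \<bullet> u\<bar>" using m by (intro mult_right_mono) auto
    moreover have "R * (4 * (s + t)) = 4 * R * (s + t)" by simp
    ultimately show ?thesis by linarith
  next
    case False
    have "cos \<phi> = cos \<theta> * (x \<bullet> y) + sin \<theta> * (y \<bullet> u)"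
      using geodist_bounds(3)[OF norms(2) e] arg_cong[OF u(3), of "\<lambda>w. y \<bullet> w"]
      by (simp add: \<theta>_def \<phi>_def inner_add_right inner_commute)
    then have "sin \<theta> * (y \<bullet> u) = (cos \<phi> - cos \<theta>) + cos \<theta> * (1 - x \<bullet> y)"
      by (simp add: algebra_simps)
    then have "\<bar>sin \<theta> * (y \<bullet> u)\<bar> \<le> \<bar>cos \<phi> - cos \<theta>\<bar> + \<bar>cos \<theta> * (1 - x \<bullet> y)\<bar>" by linarith
    also have "\<bar>cos \<phi> - cos \<theta>\<bar> \<le> \<alpha> * (R * (2 * t + s))"
      using abs_cos_diff_le[of \<phi> \<alpha> \<theta>] angles D(2) \<alpha>
      by (smt (verit) mult_left_mono)
    also have "\<bar>cos \<theta> * (1 - x \<bullet> y)\<bar> \<le> R\<^sup>2 / 2"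
    proof -
      have "0 \<le> 1 - x \<bullet> y" using norm_cauchy_schwarz[of x y] norms by simp
      moreover have "(geodist x y)\<^sup>2 \<le> R\<^sup>2"
        using D(1) geodist_bounds(1)[OF norms(1,2)] by (intro power_mono)
      then have "1 - x \<bullet> y \<le> R\<^sup>2 / 2" using norm_diff_le_geodist(2)[OF norms(1,2)] by linarith
      moreover have "\<bar>cos \<theta>\<bar> * (1 - x \<bullet> y) \<le> 1 * (1 - x \<bullet> y)"
        using calculation by (intro mult_right_mono) (auto simp: abs_cos_le_one)
      ultimately show ?thesis by (simp add: abs_mult)
    qed
    also have "\<alpha> * (R * (2 * t + s)) + R\<^sup>2 / 2 \<le> \<alpha> * (2 * R * (s + t))"
    proof -
      have "R\<^sup>2 = \<alpha> * (R * s)" by (simp add: R_def power2_eq_square)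
      moreover have "0 \<le> \<alpha> * (R * s)" using \<alpha> R s by simp
      ultimately show ?thesis by (simp add: algebra_simps)
    qed
    finally have "sin \<theta> * \<bar>y \<bullet> u\<bar> \<le> \<alpha> * (2 * R * (s + t))"
      using sin_ge_zero[of \<theta>] angles \<alpha> by (simp add: abs_mult)
    moreover have "m * (\<alpha> / 2) \<le> sin \<theta>"
      using sin_ge[of \<theta>] angles False m(1) mult_left_mono[of "\<alpha> / 2" \<theta> m] by linarith
    then have "m * (\<alpha> / 2) * \<bar>y \<bullet> u\<bar> \<le> sin \<theta> * \<bar>y \<bullet> u\<bar>" by (intro mult_right_mono) auto
    moreover have "m * (\<alpha> / 2) * \<bar>y \<bullet> u\<bar> = \<alpha> * (m * \<bar>y \<bullet> u\<bar>) / 2"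
      "\<alpha> * (4 * R * (s + t)) = 2 * (\<alpha> * (2 * R * (s + t)))" by simp_all
    ultimately have "\<alpha> * (m * \<bar>y \<bullet> u\<bar>) \<le> \<alpha> * (4 * R * (s + t))" by linarith
    then show ?thesis using \<alpha> by simp
  qed
  then show "\<bar>y \<bullet> u\<bar> \<le> 4 * (\<alpha> * s) * (s + edge x) / m"
    using m by (simp add: R_def t_def pos_le_divide_eq mult.commute)
qed


text \<open>
  Sizes for the box inside a \<open>\<rho>\<close>-ball: its edges are \<open>box_scale\<close> times those of the box around the
  ball, up to constants, and the radial projection of a point of the box to the sphere has distance
  at most \<open>tang_factor * b\<close> to the line through \<open>x\<close>, where \<open>b\<close> is as in \<open>rho_ball_supset_box\<close>.  The value
  of \<open>box_scale\<close> makes the curvature term there, quadratic in \<open>box_scale\<close>, small against the linear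
  main term.
\<close>

definition tang_factor :: real where "tang_factor = 2 * (real CARD('n) + 4)"
definition box_scale :: real where "box_scale = m\<^sup>2 / (100 * tang_factor\<^sup>2)"

lemma box_scale:
  shows "12 \<le> tang_factor" "0 < box_scale" "tang_factor * box_scale \<le> 1 / 1000" "tang_factor\<^sup>2 * box_scale = m\<^sup>2 / 100" "box_scale \<le> m\<^sup>2 / 100"
proof -
  show N: "12 \<le> tang_factor" using dim by (simp add: tang_factor_def)
  then show "0 < box_scale" using m by (simp add: box_scale_def)
  show eq: "tang_factor\<^sup>2 * box_scale = m\<^sup>2 / 100" using N by (simp add: box_scale_def)
  have m2: "m\<^sup>2 \<le> 1" using m by (simp add: power_le_one)
  have "12 * (tang_factor * box_scale) \<le> tang_factor * (tang_factor * box_scale)"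
    using N \<open>0 < box_scale\<close> by (intro mult_right_mono) auto
  then show "tang_factor * box_scale \<le> 1 / 1000" using eq m2 by (simp add: power2_eq_square)
  have "1 * box_scale \<le> tang_factor\<^sup>2 * box_scale"
    using N \<open>0 < box_scale\<close> by (intro mult_right_mono) (auto simp: one_le_power)
  then show "box_scale \<le> m\<^sup>2 / 100" using eq by simp
qed

text \<open>
  With \<open>R\<close>, \<open>t\<close>, \<open>\<theta>\<close>, \<open>\<phi>\<close> as for the upper bound and \<open>y\<close> the projection of \<open>z\<close>, the point is to
  control \<open>\<phi>\<close>.  If \<open>\<theta> < \<alpha> / 2\<close>, the square root is Lipschitz near \<open>\<alpha> - \<theta>\<close> and \<open>\<bar>\<phi> - \<theta>\<bar> \<le> d(x,y)\<close> is
  small enough.  Otherwise \<open>cos \<phi> - cos \<theta>\<close> equals \<open>sin \<theta> (y \<bullet> u)\<close> up to the curvature term.  As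
  \<open>y \<bullet> u\<close> lies between \<open>a\<close> and \<open>4 a\<close>, this difference is positive, so that \<open>y\<close> is further inside
  the cap than \<open>x\<close>, and at most of order \<open>\<alpha> R (s + t)\<close>, so that \<open>y\<close> is deeper by no more than
  \<open>h = R (s + t) / 4\<close>, as the thickness of the \<open>\<rho>\<close>-ball allows.
\<close>

lemma rho_ball_supset_box:
  fixes x u z :: "real^'n" and a b s :: real
  assumes x: "x \<in> cap e \<alpha>" and s: "0 < s" "s \<le> 1"
    and u: "norm u = 1" "x \<bullet> u = 0" "e = cos (geodist x e) *\<^sub>R x + sin (geodist x e) *\<^sub>R u"
  defines "b \<equiv> box_scale * (\<alpha> * s)"
  defines "a \<equiv> b * (s + edge x)"
  assumes z: "1/2 \<le> z \<bullet> x" "z \<bullet> x \<le> 3/4" "a \<le> z \<bullet> u" "z \<bullet> u \<le> 2 * a"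
    "norm (z - (z \<bullet> x) *\<^sub>R x) \<le> 2 * a + CARD('n) * b"
  shows "norm z < 1 \<and> z /\<^sub>R norm z \<in> rho_ball e \<alpha> x s"
proof -
  define R t \<theta> where "R = \<alpha> * s" and "t = edge x" and "\<theta> = geodist x e"
  have nx: "norm x = 1" using mem_capD[OF x] by simp
  have R: "0 < R" "R \<le> \<alpha>" using \<alpha> s by (auto simp: R_def mult_left_le)
  have t: "0 \<le> t" "t \<le> 1" "\<alpha> * t\<^sup>2 = \<alpha> - \<theta>" using edge[OF x] by (auto simp: t_def \<theta>_def)
  have \<theta>: "0 \<le> \<theta>" "\<theta> \<le> \<alpha>"
    using geodist_bounds[OF nx e] mem_capD[OF x] by (auto simp: \<theta>_def)
  have b: "0 < b" "b = box_scale * R" using R box_scale by (auto simp: b_def R_def)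
  have a: "0 < a" "a \<le> 2 * b" "a = b * (s + t)"
    using b s t mult_left_mono[of "s + t" 2 b] by (auto simp: a_def t_def)
  let ?zp = "z - (z \<bullet> x) *\<^sub>R x"
  have zp: "norm ?zp \<le> tang_factor * b / 2"
    using z(5) a b by (simp add: tang_factor_def algebra_simps)
  have "tang_factor * b = (tang_factor * box_scale) * R" by (simp add: b)
  also have "\<dots> \<le> 1 / 1000 * R" using box_scale R by (intro mult_right_mono) auto
  finally have Nb: "tang_factor * b \<le> R / 1000" by simp
  have nz: "1 / 2 \<le> norm z" "norm z < 1"
  proof -
    show "1 / 2 \<le> norm z" using z(1) norm_cauchy_schwarz[of z x] nx by simp
    have "norm z \<le> norm ((z \<bullet> x) *\<^sub>R x) + norm ?zp"
      by (metis add.commute diff_add_cancel norm_triangle_ineq)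
    moreover have "norm ((z \<bullet> x) *\<^sub>R x) \<le> 3 / 4" using z nx by simp
    ultimately show "norm z < 1" using zp Nb R \<alpha> pi_less_4 by linarith
  qed
  define y where "y = z /\<^sub>R norm z"
  have z0: "z \<noteq> 0" using nz by auto
  have ny: "norm y = 1" using z0 by (simp add: y_def)
  have yx: "0 \<le> x \<bullet> y" using z(1) by (simp add: y_def inner_commute)
  have "y - (x \<bullet> y) *\<^sub>R x = ?zp /\<^sub>R norm z"
    by (simp add: y_def scaleR_right_diff_distrib inner_commute)
  then have "norm (y - (x \<bullet> y) *\<^sub>R x) = norm ?zp / norm z" by (simp add: divide_inverse_commute)
  also have "\<dots> \<le> (tang_factor * b / 2) / (1 / 2)" using zp nz b box_scale(1) by (intro frac_le) auto
  finally have tang: "norm (y - (x \<bullet> y) *\<^sub>R x) \<le> tang_factor * b" by simp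
  have D: "geodist x y \<le> 2 * (tang_factor * b)" "1 - x \<bullet> y \<le> (tang_factor * b)\<^sup>2"
    using geodist_le_tangential[OF nx ny yx] tang power_mono[OF tang, of 2] by auto
  have D0: "0 \<le> geodist x y" "0 \<le> 1 - x \<bullet> y"
    using geodist_bounds[OF nx ny] norm_cauchy_schwarz[of x y] nx ny by auto
  have w: "a \<le> y \<bullet> u" "y \<bullet> u \<le> 4 * a"
  proof -
    have eq: "y \<bullet> u = (z \<bullet> u) / norm z" by (simp add: y_def divide_inverse_commute)
    have "a * norm z \<le> a * 1" using a nz by (intro mult_left_mono) auto
    then show "a \<le> y \<bullet> u" unfolding eq using z nz by (subst pos_le_divide_eq) auto
    have "(z \<bullet> u) / norm z \<le> (2 * a) / (1 / 2)" using z nz a by (intro frac_le) auto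
    then show "y \<bullet> u \<le> 4 * a" unfolding eq by simp
  qed
  define \<phi> where "\<phi> = geodist y e"
  have \<phi>: "0 \<le> \<phi>" "\<phi> \<le> pi" using geodist_bounds[OF ny e] by (auto simp: \<phi>_def)
  have "\<phi> \<le> \<alpha> \<and> \<bar>sqrt (bdist e \<alpha> x) - sqrt (bdist e \<alpha> y)\<bar> \<le> sqrt \<alpha> * s / 2"
  proof (cases "\<theta> < \<alpha> / 2")
    case True
    have "\<phi> \<le> geodist x y + \<theta>" "\<theta> \<le> geodist x y + \<phi>"
      using geodist_triangle[OF ny nx e] geodist_triangle[OF nx ny e]
      by (auto simp: \<phi>_def \<theta>_def geodist_commute)
    then have "\<bar>(\<alpha> - \<theta>) - (\<alpha> - \<phi>)\<bar> \<le> R / 4"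
      using D(1) Nb R by linarith
    then have "\<bar>(\<alpha> - \<theta>) - (\<alpha> - \<phi>)\<bar> \<le> \<alpha> * s / 4" by (simp add: R_def)
    moreover from this have "\<phi> \<le> \<alpha>" using R True unfolding R_def by linarith
    ultimately show ?thesis
      using True \<alpha> diff_le_imp_sqrt_diff_le_inner[of \<alpha> "\<alpha> - \<phi>" "\<alpha> - \<theta>" s]
      by (simp add: bdist_def \<phi>_def \<theta>_def)
  next
    case False
    \<comment> \<open>Both the main term and the curvature term are compared with multiples of \<open>S\<close>.\<close>
    define S where "S = \<alpha> * (R * (s + t))"
    have S: "0 < S" using \<alpha> R s t by (simp add: S_def)
    \<comment> \<open>One of the factors \<open>R\<close> in the curvature term is \<open>\<alpha> s \<le> \<alpha> (s + t)\<close>.\<close>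
    have "(tang_factor * b)\<^sup>2 = (tang_factor\<^sup>2 * box_scale) * (box_scale * (R * R))"
      by (simp add: b power2_eq_square)
    also have "\<dots> = m\<^sup>2 / 100 * (box_scale * (R * R))" using box_scale by simp
    also have "\<dots> \<le> m\<^sup>2 / 100 * (box_scale * S)"
      using \<alpha> R s t box_scale by (intro mult_left_mono) (auto simp: S_def R_def algebra_simps)
    finally have curv: "1 - x \<bullet> y \<le> m\<^sup>2 / 100 * (box_scale * S)" using D(2) by linarith
    have cs: "\<bar>cos \<theta> * (1 - x \<bullet> y)\<bar> \<le> m\<^sup>2 / 100 * (box_scale * S)"
    proof -
      have "\<bar>cos \<theta>\<bar> * (1 - x \<bullet> y) \<le> 1 * (1 - x \<bullet> y)"
        using D0 by (intro mult_right_mono) (auto simp: abs_cos_le_one)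
      then show ?thesis using curv D0 by (simp add: abs_mult)
    qed
    have aS: "\<alpha> * a = box_scale * S" by (simp add: a b S_def)
    have cosdiff: "cos \<phi> - cos \<theta> = sin \<theta> * (y \<bullet> u) - cos \<theta> * (1 - x \<bullet> y)"
      using geodist_bounds(3)[OF ny e] arg_cong[OF u(3), of "\<lambda>w. y \<bullet> w"]
      by (simp add: \<theta>_def \<phi>_def inner_add_right inner_commute algebra_simps)
    have sin\<theta>: "m * (\<alpha> / 2) \<le> sin \<theta>" "sin \<theta> \<le> \<alpha>" "0 \<le> sin \<theta>"
      using sin_ge[of \<theta>] \<theta> False m(1) mult_left_mono[of "\<alpha> / 2" \<theta> m] sin_x_le_x[of \<theta>]
        sin_ge_zero[of \<theta>] \<alpha> by linarith+
    have "m\<^sup>2 \<le> m" using m by (simp add: power2_eq_square mult_left_le)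
    with m have m2: "m\<^sup>2 \<le> m" "m\<^sup>2 \<le> 1" by auto
    have sS: "0 < box_scale * S" using box_scale S by simp
    have "m / 2 * (box_scale * S) = m * (\<alpha> / 2) * a" using aS by simp
    also have "\<dots> \<le> sin \<theta> * (y \<bullet> u)"
      using sin\<theta> w a m \<alpha> by (intro mult_mono) auto
    finally have low: "m / 2 * (box_scale * S) \<le> sin \<theta> * (y \<bullet> u)" .
    have "m\<^sup>2 / 100 * (box_scale * S) \<le> m / 2 * (box_scale * S)"
      using sS m2 m by (intro mult_right_mono) auto
    then have "cos \<theta> \<le> cos \<phi>" using low cs cosdiff by linarith
    then have \<phi>\<theta>: "\<phi> \<le> \<theta>" using \<phi> \<theta> \<alpha> by (subst (asm) cos_mono_le_eq) auto
    have "sin \<theta> * (y \<bullet> u) \<le> \<alpha> * (4 * a)"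
      using sin\<theta> w a \<alpha> by (intro mult_mono) auto
    moreover have "m\<^sup>2 / 100 * (box_scale * S) \<le> 1 * (box_scale * S)"
      using sS m2 by (intro mult_right_mono) auto
    ultimately have up: "cos \<phi> - cos \<theta> \<le> 5 * (box_scale * S)" using cs cosdiff aS by linarith
    define h where "h = R * (s + t) / 4"
    have h: "0 \<le> h" "h \<le> \<alpha> / 2"
    proof -
      show "0 \<le> h" using R s t by (simp add: h_def)
      have "R * (s + t) \<le> \<alpha> * 2" using R s t by (intro mult_mono) auto
      then show "h \<le> \<alpha> / 2" by (simp add: h_def)
    qed
    have "\<theta> - h \<le> \<phi>"
    proof (rule ccontr)
      assume "\<not> \<theta> - h \<le> \<phi>"
      then have "cos (\<theta> - h) \<le> cos \<phi>"
        using h False \<phi> \<theta> \<alpha> by (intro cos_monotone_0_pi_le) auto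
      moreover have "cos (\<theta> - h) - cos \<theta> = 2 * (sin (\<theta> - h / 2) * sin (h / 2))"
        by (simp add: cos_diff_cos algebra_simps add_divide_distrib diff_divide_distrib)
      moreover have "m * (\<alpha> / 4) * (m * (h / 2)) \<le> sin (\<theta> - h / 2) * sin (h / 2)"
      proof (intro mult_mono)
        show "m * (\<alpha> / 4) \<le> sin (\<theta> - h / 2)"
          using sin_ge[of "\<theta> - h / 2"] h False \<theta> m(1)
            mult_left_mono[of "\<alpha> / 4" "\<theta> - h / 2" m] by linarith
        show "m * (h / 2) \<le> sin (h / 2)" using sin_ge[of "h / 2"] h by linarith
        show "0 \<le> sin (\<theta> - h / 2)" using h False \<theta> \<alpha> by (intro sin_ge_zero) auto
      qed (use m h in auto)
      moreover have "m * (\<alpha> / 4) * (m * (h / 2)) = m\<^sup>2 / 32 * S"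
        by (simp add: h_def S_def power2_eq_square)
      ultimately have "m\<^sup>2 / 16 * S \<le> 5 * (box_scale * S)" using up by linarith
      moreover have "box_scale * S \<le> m\<^sup>2 / 100 * S" using box_scale S by (intro mult_right_mono) auto
      moreover have "0 < m\<^sup>2 * S" using m S by simp
      ultimately show False by simp
    qed
    then have "\<bar>sqrt \<alpha> * t - sqrt (\<alpha> - \<phi>)\<bar> \<le> sqrt \<alpha> * s / 2"
      using \<alpha> t s \<phi>\<theta> by (intro diff_le_imp_sqrt_diff_le) (auto simp: h_def R_def add.commute[of s t])
    then show ?thesis
      using \<phi>\<theta> \<theta> edge(4)[OF x] by (simp add: t_def bdist_def \<phi>_def)
  qed
  moreover have "\<bar>geodist x y\<bar> \<le> \<alpha> * s / 2"
    using D(1) D0 Nb R by (simp add: R_def)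
  ultimately have "y \<in> rho_ball e \<alpha> x s"
    using \<alpha> s ny cap_rho_leI[of \<alpha> s x y e] by (simp add: rho_ball_def cap_def \<phi>_def)
  then show ?thesis using nz(2) by (simp add: y_def)
qed

end

section \<open>Measure of the balls of the cap metric\<close>

lemma continuous_on_geodist:
  fixes x :: "real^'n"
  assumes "norm x = 1"
  shows "continuous_on (sphere 0 1) (geodist x)" "continuous_on (sphere 0 1) (\<lambda>y. geodist y x)"
proof -
  have "continuous_on (sphere 0 1) (\<lambda>y. arccos (x \<bullet> y))"
  proof (rule continuous_on_arccos)
    show "\<forall>y\<in>sphere 0 1. - 1 \<le> x \<bullet> y \<and> x \<bullet> y \<le> 1"
    proof
      fix y :: "real^'n" assume "y \<in> sphere 0 1"
      then show "- 1 \<le> x \<bullet> y \<and> x \<bullet> y \<le> 1"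
        using Cauchy_Schwarz_ineq2[of x y] assms by (simp add: abs_le_iff minus_le_iff)
    qed
  qed (intro continuous_intros)
  then show "continuous_on (sphere 0 1) (\<lambda>y. geodist y x)"
    by (simp add: geodist_def inner_commute)
  then show "continuous_on (sphere 0 1) (geodist x)"
    by (simp add: geodist_commute[of x] cong: continuous_on_cong)
qed

lemma closed_cap:
  assumes "norm e = 1"
  shows "closed (cap e \<alpha>)"
proof -
  have "closed (sphere 0 1 \<inter> (\<lambda>y. geodist y e) -` {..\<alpha>})"
    by (intro continuous_closed_preimage continuous_on_geodist assms) auto
  moreover have "sphere 0 1 \<inter> (\<lambda>y. geodist y e) -` {..\<alpha>} = cap e \<alpha>" by (auto simp: cap_def)
  ultimately show ?thesis by simp
qed

lemma closed_rho_ball: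
  assumes "norm e = 1" "norm x = 1"
  shows "closed (rho_ball e \<alpha> x s)"
proof -
  have "continuous_on (sphere 0 1) (cap_rho e \<alpha> x)"
    unfolding cap_rho_def[abs_def] bdist_def
    by (intro continuous_intros continuous_on_geodist assms)
  then have "closed (sphere 0 1 \<inter> cap_rho e \<alpha> x -` {..s})"
    by (intro continuous_closed_preimage) auto
  then have "closed (cap e \<alpha> \<inter> (sphere 0 1 \<inter> cap_rho e \<alpha> x -` {..s}))"
    by (rule closed_Int[OF closed_cap[OF assms(1)]])
  moreover have "cap e \<alpha> \<inter> (sphere 0 1 \<inter> cap_rho e \<alpha> x -` {..s}) = rho_ball e \<alpha> x s"
    by (auto simp: rho_ball_def cap_def)
  ultimately show ?thesis by simp
qed

lemma sets_cap: "norm e = 1 \<Longrightarrow> cap e \<alpha> \<in> sets sphere_measure"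
  using closed_cap[of e \<alpha>] by (intro sets_sphere_measureI) (auto simp: cap_def)

lemma sets_rho_ball: "norm e = 1 \<Longrightarrow> norm x = 1 \<Longrightarrow> rho_ball e \<alpha> x s \<in> sets sphere_measure"
  using closed_rho_ball[of e x \<alpha> s] by (intro sets_sphere_measureI) (auto simp: rho_ball_def cap_def)

lemma tri_nonneg:
  assumes "x \<in> cap e \<alpha>" "0 < \<alpha>" "0 \<le> s"
  shows "0 \<le> tri d e \<alpha> s x"
  using assms mem_capD(2)[OF assms(1)] by (simp add: tri_def)

text \<open>
  Used to pass from the balls of radius \<open>s\<close> that cover the cap to disjoint balls of radius
  \<open>s / 3\<close>.
\<close>

lemma tri_third_ge:
  assumes "x \<in> cap e \<alpha>" "0 < \<alpha>" "0 \<le> s"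
  shows "tri d e \<alpha> s x \<le> 3 ^ (d + 1) * tri d e \<alpha> (s / 3) x"
proof -
  let ?t = "sqrt (1 - geodist x e / \<alpha>)"
  have "0 \<le> ?t" using assms mem_capD(2)[OF assms(1)] by simp
  then have "0 \<le> \<alpha> ^ d * (s ^ d * ?t)" using assms by simp
  then have "tri d e \<alpha> s x \<le> \<alpha> ^ d * (s ^ (d + 1) + 3 * (s ^ d * ?t))"
    by (simp add: tri_def algebra_simps)
  also have "\<dots> = 3 ^ (d + 1) * tri d e \<alpha> (s / 3) x"
    by (simp add: tri_def field_simps)
  finally show ?thesis .
qed

context cap_geometry
begin

definition upper_const :: real where
  "upper_const = CARD('n) * (16 / m * 2 ^ (CARD('n) - 2))"

definition lower_const :: real where
  "lower_const = CARD('n) * (box_scale ^ (CARD('n) - 1) * 2 ^ (CARD('n) - 2) / 4)"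

lemma const_pos: "0 < upper_const" "0 < lower_const"
  using m box_scale(2) by (auto simp: upper_const_def lower_const_def)

text \<open>
  By the two box lemmas: with \<open>R = \<alpha> s\<close>, both boxes have one edge of order \<open>1\<close>, one of order
  \<open>R (s + edge x)\<close> and \<open>d - 1\<close> of order \<open>R\<close>, and the product of these is \<open>\<triangle>\<^sub>s(x)\<close>.
\<close>

lemma measure_rho_ball:
  assumes x: "x \<in> cap e \<alpha>" and s: "0 < s" "s \<le> 1" and d: "CARD('n) = d + 1"
  shows "measure sphere_measure (rho_ball e \<alpha> x s) \<le> upper_const * tri d e \<alpha> s x"
    and "lower_const * tri d e \<alpha> s x \<le> measure sphere_measure (rho_ball e \<alpha> x s)"
proof -
  have nx: "norm x = 1" using mem_capD[OF x] by simp
  obtain k where k: "d = Suc k" using d dim by (cases d) auto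
  have exps: "CARD('n) - 2 = k" "CARD('n) - 1 = Suc k" using k d by auto
  obtain u where u: "norm u = 1" "x \<bullet> u = 0" "e = cos (geodist x e) *\<^sub>R x + sin (geodist x e) *\<^sub>R u"
    using meridian_direction[OF nx e dim] by blast
  have E: "rho_ball e \<alpha> x s \<in> sets sphere_measure" by (rule sets_rho_ball[OF e nx])
  let ?a = "4 * (\<alpha> * s) * (s + edge x) / m" and ?b = "box_scale * (\<alpha> * s)"
  have "measure sphere_measure (rho_ball e \<alpha> x s) \<le>
      CARD('n) * (4 * ?a * (2 * (\<alpha> * s)) ^ (CARD('n) - 2))"
    using rho_ball_subset_slab[OF x s _ u] \<alpha> s m edge[OF x]
    by (intro measure_sphere_le_box[OF nx u(1,2) _ _ dim E]) auto
  also have "\<dots> = upper_const * tri d e \<alpha> s x"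
    unfolding upper_const_def tri_eq exps by (simp add: k power_mult_distrib)
  finally show "measure sphere_measure (rho_ball e \<alpha> x s) \<le> upper_const * tri d e \<alpha> s x" .
  have "lower_const * tri d e \<alpha> s x = CARD('n) * (?b * (s + edge x) / 4 * (2 * ?b) ^ (CARD('n) - 2))"
    unfolding lower_const_def tri_eq exps by (simp add: k power_mult_distrib)
  also have "\<dots> \<le> measure sphere_measure (rho_ball e \<alpha> x s)"
    using \<alpha> s box_scale(2) edge[OF x]
    by (intro measure_sphere_ge_box[OF nx u(1,2) _ _ dim E] rho_ball_supset_box[OF x s u]) auto
  finally show "lower_const * tri d e \<alpha> s x \<le> measure sphere_measure (rho_ball e \<alpha> x s)" .
qed

end

section \<open>Integrals over the cap and sums over separated sets\<close>

lemma powr_add_le: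
  fixes a b p :: real
  assumes "0 \<le> a" "0 \<le> b" "1 \<le> p"
  shows "(a + b) powr p \<le> 2 powr (p - 1) * (a powr p + b powr p)"
proof (cases "a = 0 \<or> b = 0")
  case True
  have "1 \<le> 2 powr (p - 1)" using assms by (simp add: ge_one_powr_ge_zero)
  then have "1 * c \<le> 2 powr (p - 1) * c" if "0 \<le> c" for c
    using that by (intro mult_right_mono)
  from this[of "a powr p"] this[of "b powr p"] show ?thesis using True assms by auto
next
  case False
  have "((1 - 1/2) *\<^sub>R a + (1/2) *\<^sub>R b) powr p \<le> (1 - 1/2) * a powr p + (1/2) * b powr p"
    by (rule convex_onD[OF powr_convex[OF assms(3)]]) (use False assms in auto)
  then have "2 powr p * ((a + b) / 2) powr p \<le> 2 powr p * ((a powr p + b powr p) / 2)"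
    by (intro mult_left_mono) (auto simp: add_divide_distrib)
  also have "2 powr p * ((a + b) / 2) powr p = (a + b) powr p"
  proof -
    have "2 * ((a + b) / 2) = a + b" by (simp add: field_simps)
    then show ?thesis by (simp only: powr_mult[symmetric])
  qed
  also have "2 powr p * ((a powr p + b powr p) / 2) = 2 powr (p - 1) * (a powr p + b powr p)"
    by (simp add: powr_diff)
  finally show ?thesis .
qed

lemma continuous_on_spherical_poly:
  fixes f :: "real^'n \<Rightarrow> real"
  assumes "f \<in> spherical_polys n"
  shows "continuous_on (sphere 0 1) f"
proof -
  obtain c :: "('n \<Rightarrow> nat) \<Rightarrow> real" where
    c: "\<forall>x\<in>sphere 0 1. f x = (\<Sum>k | (\<Sum>i\<in>UNIV. k i) \<le> n. c k * (\<Prod>i\<in>UNIV. (x $ i) ^ k i))"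
    using assms by (auto simp: spherical_polys_def)
  have "continuous_on (sphere 0 1)
      (\<lambda>x. \<Sum>k | (\<Sum>i\<in>UNIV. k i) \<le> n. c k * (\<Prod>i\<in>UNIV. (x $ i) ^ k i))"
    by (intro continuous_intros)
  then show ?thesis by (rule continuous_on_eq) (use c in simp)
qed

locale spherical_integrand =
  fixes e :: "real^'n" and \<alpha> p B :: real and f :: "real^'n \<Rightarrow> real"
  assumes p: "1 \<le> p" and B: "\<And>x. norm x = 1 \<Longrightarrow> \<bar>f x\<bar> \<le> B"
    and norm_e: "norm e = 1" and cont: "continuous_on (sphere 0 1) f"
begin

lemma powr_le: "norm x = 1 \<Longrightarrow> \<bar>f x\<bar> powr p \<le> B powr p"
  using B p by (intro powr_mono2) auto

lemma le_max_pow: "x \<in> rho_ball e \<alpha> \<omega> r \<Longrightarrow> \<bar>f x\<bar> powr p \<le> max_pow e \<alpha> p f \<omega> r"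
  unfolding max_pow_def
  by (rule cSUP_upper) (auto intro!: bdd_aboveI2[of _ _ "B powr p"] powr_le simp: rho_ball_def cap_def)

lemma min_pow_le: "x \<in> rho_ball e \<alpha> \<omega> r \<Longrightarrow> min_pow e \<alpha> p f \<omega> r \<le> \<bar>f x\<bar> powr p"
  unfolding min_pow_def by (rule cINF_lower) (auto intro: bdd_belowI2[of _ 0])

lemma min_pow_nonneg: "rho_ball e \<alpha> \<omega> r \<noteq> {} \<Longrightarrow> 0 \<le> min_pow e \<alpha> p f \<omega> r"
  unfolding min_pow_def by (rule cINF_greatest) auto

lemma le_max_osc:
  assumes "x \<in> rho_ball e \<alpha> \<omega> r" "y \<in> rho_ball e \<alpha> \<omega> r"
  shows "\<bar>f x - f y\<bar> powr p \<le> max_osc e \<alpha> p f \<omega> r"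
proof -
  let ?S = "rho_ball e \<alpha> \<omega> r \<times> rho_ball e \<alpha> \<omega> r"
  let ?h = "\<lambda>(x, y). \<bar>f x - f y\<bar> powr p"
  have "?h z \<le> (2 * B) powr p" if "z \<in> ?S" for z
  proof -
    obtain v w where z: "z = (v, w)" by (cases z)
    with that have "norm v = 1" "norm w = 1" by (auto simp: rho_ball_def cap_def)
    then have "\<bar>f v - f w\<bar> \<le> 2 * B" using B[of v] B[of w] by linarith
    then show ?thesis using p z by (auto intro: powr_mono2)
  qed
  then have "bdd_above (?h ` ?S)" by (rule bdd_aboveI2)
  then have "?h (x, y) \<le> (SUP z\<in>?S. ?h z)" using assms by (intro cSUP_upper) auto
  then show ?thesis by (simp add: max_osc_def)
qed

text \<open>
  For all \<open>x\<close>, \<open>y\<close> in the ball, \<open>\<bar>f x\<bar> \<le> \<bar>f y\<bar> + \<bar>f x - f y\<bar>\<close>; now apply convexity of the power.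
\<close>

lemma max_pow_le:
  assumes ne: "rho_ball e \<alpha> \<omega> r \<noteq> {}"
  shows "max_pow e \<alpha> p f \<omega> r \<le> 2 powr (p - 1) * (min_pow e \<alpha> p f \<omega> r + max_osc e \<alpha> p f \<omega> r)"
  unfolding max_pow_def
proof (rule cSUP_least[OF ne])
  fix x assume x: "x \<in> rho_ball e \<alpha> \<omega> r"
  let ?c = "2 powr (p - 1) :: real"
  have "\<bar>f x\<bar> powr p / ?c - max_osc e \<alpha> p f \<omega> r \<le> min_pow e \<alpha> p f \<omega> r"
    unfolding min_pow_def
  proof (rule cINF_greatest[OF ne])
    fix y assume y: "y \<in> rho_ball e \<alpha> \<omega> r"
    have "\<bar>f x\<bar> powr p \<le> (\<bar>f y\<bar> + \<bar>f x - f y\<bar>) powr p"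
      using p by (intro powr_mono2) auto
    also have "\<dots> \<le> ?c * (\<bar>f y\<bar> powr p + \<bar>f x - f y\<bar> powr p)"
      using p by (intro powr_add_le) auto
    also have "\<dots> \<le> ?c * (\<bar>f y\<bar> powr p + max_osc e \<alpha> p f \<omega> r)"
      using le_max_osc[OF x y] by (intro mult_left_mono add_left_mono) auto
    finally show "\<bar>f x\<bar> powr p / ?c - max_osc e \<alpha> p f \<omega> r \<le> \<bar>f y\<bar> powr p"
      by (simp add: pos_divide_le_eq diff_le_eq mult.commute)
  qed
  then have "\<bar>f x\<bar> powr p / ?c \<le> min_pow e \<alpha> p f \<omega> r + max_osc e \<alpha> p f \<omega> r" by simp
  then show "\<bar>f x\<bar> powr p \<le> ?c * (min_pow e \<alpha> p f \<omega> r + max_osc e \<alpha> p f \<omega> r)"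
    by (simp add: pos_divide_le_eq mult.commute)
qed

lemma min_pow_le_max_pow: "rho_ball e \<alpha> \<omega> r \<noteq> {} \<Longrightarrow> min_pow e \<alpha> p f \<omega> r \<le> max_pow e \<alpha> p f \<omega> r"
  using min_pow_le le_max_pow by (meson all_not_in_conv order_trans)

lemma integrable_cap: "integrable sphere_measure (\<lambda>x. indicator (cap e \<alpha>) x * \<bar>f x\<bar> powr p)"
proof -
  interpret finite_measure "sphere_measure :: (real^'n) measure" by (rule finite_measure_sphere_measure)
  have "continuous_on (sphere 0 1) (\<lambda>x. \<bar>f x\<bar> powr p)"
    using p by (intro continuous_on_powr' continuous_intros cont) auto
  then have [measurable]: "(\<lambda>x. \<bar>f x\<bar> powr p) \<in> borel_measurable sphere_measure"
    by (simp add: borel_measurable_continuous_on_restrict cong: measurable_cong_sets[OF sets_sphere_measure refl])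
  have [measurable]: "cap e \<alpha> \<in> sets sphere_measure" by (rule sets_cap[OF norm_e])
  show ?thesis
    by (rule integrable_const_bound[where B = "B powr p"])
       (auto simp: indicator_def intro!: powr_le AE_I2)
qed

lemma cap_integral_eq: "cap_integral e \<alpha> p f = (LINT x|sphere_measure. indicator (cap e \<alpha>) x * \<bar>f x\<bar> powr p)"
  by (simp add: cap_integral_def set_lebesgue_integral_def)

lemma integral_indicator_sum:
  assumes "finite \<Lambda>" "\<And>\<omega>. \<omega> \<in> \<Lambda> \<Longrightarrow> A \<omega> \<in> sets (sphere_measure :: (real^'n) measure)"
  shows "integrable sphere_measure (\<lambda>x :: real^'n. \<Sum>\<omega>\<in>\<Lambda>. c \<omega> * indicator (A \<omega>) x :: real)"
    and "(LINT x|sphere_measure. (\<Sum>\<omega>\<in>\<Lambda>. c \<omega> * indicator (A \<omega>) x)) = (\<Sum>\<omega>\<in>\<Lambda>. c \<omega> * measure sphere_measure (A \<omega>))"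
proof -
  interpret finite_measure "sphere_measure :: (real^'n) measure" by (rule finite_measure_sphere_measure)
  have i: "integrable sphere_measure (\<lambda>x :: real^'n. c \<omega> * indicator (A \<omega>) x)" if "\<omega> \<in> \<Lambda>" for \<omega>
    using assms(2)[OF that] by (intro integrable_mult_right integrable_real_indicator) (auto simp flip: less_top)
  show "integrable sphere_measure (\<lambda>x :: real^'n. \<Sum>\<omega>\<in>\<Lambda>. c \<omega> * indicator (A \<omega>) x :: real)"
    by (rule Bochner_Integration.integrable_sum) (rule i)
  have "A \<omega> \<inter> sphere 0 1 = A \<omega>" if "\<omega> \<in> \<Lambda>" for \<omega>
    using sets.sets_into_space[OF assms(2)[OF that]] by auto
  then show "(LINT x|sphere_measure. (\<Sum>\<omega>\<in>\<Lambda>. c \<omega> * indicator (A \<omega>) x)) = (\<Sum>\<omega>\<in>\<Lambda>. c \<omega> * measure sphere_measure (A \<omega>))"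
    using i by (simp add: integral_sum)
qed

text \<open>
  The balls of radius \<open>s\<close> cover the cap.
\<close>

lemma cap_integral_le_sum_max:
  assumes \<Lambda>: "maximal_rho_separable e \<alpha> s \<Lambda>" and "s \<le> r"
  shows "cap_integral e \<alpha> p f \<le> (\<Sum>\<omega>\<in>\<Lambda>. max_pow e \<alpha> p f \<omega> r * measure sphere_measure (rho_ball e \<alpha> \<omega> s))"
proof -
  have fin: "finite \<Lambda>" and sub: "\<Lambda> \<subseteq> cap e \<alpha>" and cover: "cap e \<alpha> = (\<Union>\<xi>\<in>\<Lambda>. rho_ball e \<alpha> \<xi> s)"
    using \<Lambda> by (auto simp: maximal_rho_separable_def rho_separable_def)
  have mball: "rho_ball e \<alpha> \<omega> s \<in> sets sphere_measure" if "\<omega> \<in> \<Lambda>" for \<omega>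
    using that sub by (intro sets_rho_ball norm_e) (auto dest: mem_capD)
  have "cap_integral e \<alpha> p f \<le> (LINT x|sphere_measure. (\<Sum>\<omega>\<in>\<Lambda>. max_pow e \<alpha> p f \<omega> r * indicator (rho_ball e \<alpha> \<omega> s) x))"
    unfolding cap_integral_eq
  proof (rule integral_mono)
    fix x :: "real^'n"
    have term_nonneg: "0 \<le> max_pow e \<alpha> p f \<omega> r * indicator (rho_ball e \<alpha> \<omega> s) x" for \<omega>
    proof (cases "x \<in> rho_ball e \<alpha> \<omega> s")
      case True
      then have "x \<in> rho_ball e \<alpha> \<omega> r" using \<open>s \<le> r\<close> by (simp add: rho_ball_def)
      then have "0 \<le> max_pow e \<alpha> p f \<omega> r"
        using le_max_pow powr_ge_zero order_trans by blast
      then show ?thesis by simp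
    qed simp
    show "indicator (cap e \<alpha>) x * \<bar>f x\<bar> powr p
        \<le> (\<Sum>\<omega>\<in>\<Lambda>. max_pow e \<alpha> p f \<omega> r * indicator (rho_ball e \<alpha> \<omega> s) x)"
    proof (cases "x \<in> cap e \<alpha>")
      case True
      then obtain \<omega> where \<omega>: "\<omega> \<in> \<Lambda>" "x \<in> rho_ball e \<alpha> \<omega> s" using cover by auto
      then have "x \<in> rho_ball e \<alpha> \<omega> r" using \<open>s \<le> r\<close> by (simp add: rho_ball_def)
      then have "\<bar>f x\<bar> powr p \<le> max_pow e \<alpha> p f \<omega> r * indicator (rho_ball e \<alpha> \<omega> s) x"
        using le_max_pow \<omega>(2) by simp
      also have "\<dots> \<le> (\<Sum>\<omega>\<in>\<Lambda>. max_pow e \<alpha> p f \<omega> r * indicator (rho_ball e \<alpha> \<omega> s) x)"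
        by (rule member_le_sum[OF \<omega>(1) term_nonneg fin])
      finally show ?thesis using True by simp
    next
      case False
      then show ?thesis using term_nonneg by (auto intro!: sum_nonneg)
    qed
  qed (use integrable_cap integral_indicator_sum(1)[OF fin mball] in auto)
  then show ?thesis using integral_indicator_sum(2)[OF fin mball] by simp
qed

text \<open>
  The balls of radius \<open>s / 3\<close> are disjoint by the triangle inequality for \<open>\<rho>\<close>.  Closed balls of radius
  \<open>s / 2\<close> could touch.
\<close>

lemma sum_min_le_cap_integral:
  assumes \<Lambda>: "rho_separable e \<alpha> s \<Lambda>" and "0 < \<alpha>" "0 < s" "s \<le> r"
  shows "(\<Sum>\<omega>\<in>\<Lambda>. min_pow e \<alpha> p f \<omega> r * measure sphere_measure (rho_ball e \<alpha> \<omega> (s / 3))) \<le> cap_integral e \<alpha> p f"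
proof -
  have fin: "finite \<Lambda>" and sub: "\<Lambda> \<subseteq> cap e \<alpha>"
    and sep: "\<And>\<xi> \<xi>'. \<xi> \<in> \<Lambda> \<Longrightarrow> \<xi>' \<in> \<Lambda> \<Longrightarrow> \<xi> \<noteq> \<xi>' \<Longrightarrow> s \<le> cap_rho e \<alpha> \<xi> \<xi>'"
    using \<Lambda> by (auto simp: rho_separable_def)
  have mball: "rho_ball e \<alpha> \<omega> (s / 3) \<in> sets sphere_measure" if "\<omega> \<in> \<Lambda>" for \<omega>
    using that sub by (intro sets_rho_ball norm_e) (auto dest: mem_capD)
  have disj: "\<xi> = \<xi>'" if "\<xi> \<in> \<Lambda>" "\<xi>' \<in> \<Lambda>" "x \<in> rho_ball e \<alpha> \<xi> (s / 3)" "x \<in> rho_ball e \<alpha> \<xi>' (s / 3)" for x \<xi> \<xi>'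
  proof (rule ccontr)
    assume "\<xi> \<noteq> \<xi>'"
    have "norm \<xi> = 1" "norm \<xi>' = 1" "norm x = 1"
      using that sub by (auto dest: mem_capD simp: rho_ball_def)
    then have "cap_rho e \<alpha> \<xi> \<xi>' \<le> cap_rho e \<alpha> \<xi> x + cap_rho e \<alpha> \<xi>' x"
      using cap_rho_triangle[of \<alpha> \<xi> x \<xi>' e] \<open>0 < \<alpha>\<close> by (simp add: cap_rho_commute)
    also have "\<dots> \<le> s / 3 + s / 3" using that by (intro add_mono) (auto simp: rho_ball_def)
    finally show False using sep[OF that(1,2) \<open>\<xi> \<noteq> \<xi>'\<close>] \<open>0 < s\<close> by simp
  qed
  have "(LINT x|sphere_measure. (\<Sum>\<omega>\<in>\<Lambda>. min_pow e \<alpha> p f \<omega> r * indicator (rho_ball e \<alpha> \<omega> (s / 3)) x)) \<le> cap_integral e \<alpha> p f"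
    unfolding cap_integral_eq
  proof (rule integral_mono)
    fix x :: "real^'n"
    let ?S = "\<Sum>\<omega>\<in>\<Lambda>. min_pow e \<alpha> p f \<omega> r * indicator (rho_ball e \<alpha> \<omega> (s / 3)) x"
    show "?S \<le> indicator (cap e \<alpha>) x * \<bar>f x\<bar> powr p"
    proof (cases "\<exists>\<omega>\<in>\<Lambda>. x \<in> rho_ball e \<alpha> \<omega> (s / 3)")
      case True
      then obtain \<omega> where \<omega>: "\<omega> \<in> \<Lambda>" "x \<in> rho_ball e \<alpha> \<omega> (s / 3)" by blast
      have "?S = (\<Sum>\<xi>\<in>{\<omega>}. min_pow e \<alpha> p f \<xi> r * indicator (rho_ball e \<alpha> \<xi> (s / 3)) x)"
        using fin \<omega> disj by (intro sum.mono_neutral_right) (auto simp: indicator_def)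
      also have "\<dots> = min_pow e \<alpha> p f \<omega> r" using \<omega> by simp
      also have "\<dots> \<le> \<bar>f x\<bar> powr p"
        using \<omega>(2) \<open>0 < s\<close> \<open>s \<le> r\<close> by (intro min_pow_le) (auto simp: rho_ball_def)
      finally show ?thesis using \<omega>(2) by (simp add: rho_ball_def)
    next
      case False
      then have "?S = 0" by (intro sum.neutral) auto
      then show ?thesis by simp
    qed
  qed (use integrable_cap integral_indicator_sum(1)[OF fin mball] in auto)
  then show ?thesis using integral_indicator_sum(2)[OF fin mball] by simp
qed

end

section \<open>Absorbing the oscillation\<close>

text \<open>
  In the application \<open>I\<close> is the integral, \<open>M\<close> and \<open>\<mu>\<close> are the sums of maxima and minima, \<open>c\<close> and \<open>C\<close>
  are the constants of the volume estimate, \<open>q\<close> stems from the absorption of the oscillation, and \<open>T\<close> from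
  the passage to balls of a third of the radius.
\<close>

lemma sandwich_constants:
  fixes I M \<mu> C c q T :: real
  assumes pos: "0 < c" "0 < C" "0 < q" "0 < T"
    and nonneg: "0 \<le> I" "0 \<le> \<mu>"
    and IM: "I \<le> C * M" and MI: "c * M \<le> q * (C * \<mu>)" and \<mu>I: "c * \<mu> \<le> T * I" and \<mu>M: "\<mu> \<le> M"
  shows "equiv_with (C + q * C * T / c\<^sup>2) I M" "equiv_with (1 + q * C / c) M \<mu>"
proof -
  have M: "M \<le> q * C / c * \<mu>"
    using MI pos(1) by (simp add: field_simps)
  have "\<mu> \<le> T * I / c" using \<mu>I pos(1) by (simp add: field_simps)
  then have "q * C / c * \<mu> \<le> q * C / c * (T * I / c)" using pos by (intro mult_left_mono) auto
  with M have MI': "M \<le> q * C * T / c\<^sup>2 * I" by (simp add: power2_eq_square)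
  have K: "0 < C + q * C * T / c\<^sup>2" and K': "0 < 1 + q * C / c"
    using pos by (auto intro!: add_pos_nonneg)
  have "M \<le> (C + q * C * T / c\<^sup>2) * I"
  proof -
    have "0 \<le> C * I" using pos nonneg by simp
    with MI' show ?thesis unfolding distrib_right by linarith
  qed
  moreover have "I \<le> (C + q * C * T / c\<^sup>2) * M"
  proof -
    have "0 \<le> q * C * T / c\<^sup>2 * M" using \<mu>M nonneg pos by simp
    with IM show ?thesis unfolding distrib_right by linarith
  qed
  ultimately show "equiv_with (C + q * C * T / c\<^sup>2) I M"
    using K by (simp add: equiv_with_def inverse_eq_divide pos_divide_le_eq mult.commute)
  have "M \<le> (1 + q * C / c) * \<mu>" using M nonneg by (simp add: distrib_right)
  moreover have "\<mu> \<le> (1 + q * C / c) * M"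
  proof -
    have "0 \<le> q * C / c * M" using \<mu>M nonneg pos by simp
    with \<mu>M show ?thesis unfolding distrib_right by linarith
  qed
  ultimately show "equiv_with (1 + q * C / c) M \<mu>"
    using K' by (simp add: equiv_with_def inverse_eq_divide pos_divide_le_eq mult.commute)
qed

text \<open>
  This is where \<open>\<delta> \<le> 1 / (4 C1)\<close> enters: the left-hand side is at most \<open>2 powr (p - 1) * 4 powr (- p)\<close>.
  A value below \<open>1\<close> allows the oscillation to be absorbed.
\<close>

lemma oscillation_factor_le:
  fixes C1 \<delta> p :: real
  assumes "0 < C1" "0 < \<delta>" "\<delta> \<le> 1 / (4 * C1)" "1 \<le> p"
  shows "2 powr (p - 1) * (C1 * \<delta>) powr p \<le> 1 / 4"
proof -
  have "C1 * \<delta> \<le> 1 / 4" using assms by (simp add: field_simps)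
  then have "(C1 * \<delta>) powr p \<le> (1 / 4) powr p" using assms by (intro powr_mono2) auto
  then have "2 powr (p - 1) * (C1 * \<delta>) powr p \<le> 2 powr (p - 1) * (1 / 4) powr p"
    by (intro mult_left_mono) auto
  also have "\<dots> = (2 * (1 / 4)) powr p / 2"
    by (simp only: powr_mult powr_diff powr_one)
  also have "\<dots> \<le> (1 / 2) powr 1 / 2"
  proof -
    have "(1 / 2) powr p \<le> (1 / 2 :: real) powr 1" by (rule powr_mono') (use assms in auto)
    then show ?thesis by simp
  qed
  finally show ?thesis by simp
qed

context cap_geometry
begin

text \<open>
  With \<open>V\<close> the measure of the ball of radius \<open>s\<close>, let \<open>X\<close> and \<open>Y\<close> be the sums of maxima and of
  minima weighted by \<open>V\<close> in place of \<open>\<triangle>\<^sub>s\<close>, and \<open>I\<close> the integral.  Covering gives \<open>I \<le> X\<close>; splitting each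
  maximum into minimum and oscillation gives \<open>X \<le> 2 powr (p - 1) * Y + I / 4\<close>.  As \<open>I / 4 \<le> X / 4\<close>,
  this yields \<open>X \<le> 4 / 3 * 2 powr (p - 1) * Y\<close>.  The volume estimate lets \<open>\<triangle>\<^sub>s\<close> replace \<open>V\<close> again.
\<close>

lemma marcinkiewicz_zygmund:
  fixes f :: "real^'n \<Rightarrow> real" and p \<beta> C1 \<delta> :: real and k n :: nat
  assumes d: "CARD('n) = k + 1" and p: "1 \<le> p" and \<beta>: "1 \<le> \<beta>" and C1: "0 < C1"
    and \<delta>: "0 < \<delta>" "\<delta> \<le> 1" "\<delta> \<le> 1 / (4 * C1)" and n: "0 < n"
    and \<Lambda>: "maximal_rho_separable e \<alpha> (\<delta> / real n) \<Lambda>" and f: "continuous_on (sphere 0 1) f"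
    and osc: "(\<Sum>\<omega>\<in>\<Lambda>. max_osc e \<alpha> p f \<omega> (\<beta> * \<delta> / real n)
               * measure sphere_measure (rho_ball e \<alpha> \<omega> (\<delta> / real n)))
        \<le> (C1 * \<delta>) powr p * cap_integral e \<alpha> p f"
  defines "M \<equiv> \<Sum>\<omega>\<in>\<Lambda>. max_pow e \<alpha> p f \<omega> (\<beta> * \<delta> / real n) * tri k e \<alpha> (\<delta> / real n) \<omega>"
    and "\<mu> \<equiv> \<Sum>\<omega>\<in>\<Lambda>. min_pow e \<alpha> p f \<omega> (\<beta> * \<delta> / real n) * tri k e \<alpha> (\<delta> / real n) \<omega>"
    and "K \<equiv> upper_const + (4 / 3 * 2 powr (p - 1)) * upper_const * 3 ^ (k + 1) / lower_const\<^sup>2"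
    and "K' \<equiv> 1 + (4 / 3 * 2 powr (p - 1)) * upper_const / lower_const"
  shows "equiv_with K (cap_integral e \<alpha> p f) M \<and> equiv_with K' M \<mu>"
proof -
  define s where "s = \<delta> / real n"
  define r where "r = \<beta> * \<delta> / real n"
  have s: "0 < s" "s \<le> 1" using \<delta> n by (auto simp: s_def divide_le_eq)
  have sr: "s \<le> r" using \<beta> s mult_right_mono[of 1 \<beta> s] by (simp add: r_def s_def)
  have sep: "rho_separable e \<alpha> s \<Lambda>" and sub: "\<Lambda> \<subseteq> cap e \<alpha>"
    using \<Lambda> by (auto simp: s_def maximal_rho_separable_def rho_separable_def)
  have "compact (f ` sphere 0 1)" using f by (intro compact_continuous_image) auto
  then have "bounded (f ` sphere 0 1)" by (rule compact_imp_bounded)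
  then obtain B where "\<forall>x\<in>sphere 0 1. \<bar>f x\<bar> \<le> B"
    by (auto simp: bounded_iff)
  then have B: "\<And>x. norm x = 1 \<Longrightarrow> \<bar>f x\<bar> \<le> B" by simp
  interpret spherical_integrand e \<alpha> p B f
    by unfold_locales (use p B e f in auto)
  let ?V = "\<lambda>\<omega>. measure sphere_measure (rho_ball e \<alpha> \<omega> s)"
  let ?I = "cap_integral e \<alpha> p f"
  define X Y where "X = (\<Sum>\<omega>\<in>\<Lambda>. max_pow e \<alpha> p f \<omega> r * ?V \<omega>)" and "Y = (\<Sum>\<omega>\<in>\<Lambda>. min_pow e \<alpha> p f \<omega> r * ?V \<omega>)"
  have ball_ne: "rho_ball e \<alpha> \<omega> r \<noteq> {}" if "\<omega> \<in> \<Lambda>" for \<omega>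
  proof -
    have "\<omega> \<in> rho_ball e \<alpha> \<omega> r"
      using that sub s sr cap_rho_self[of \<omega>] mem_capD(1)[of \<omega> e \<alpha>] by (auto simp: rho_ball_def)
    then show ?thesis by blast
  qed
  have min0: "0 \<le> min_pow e \<alpha> p f \<omega> r" and min_max: "min_pow e \<alpha> p f \<omega> r \<le> max_pow e \<alpha> p f \<omega> r"
    if "\<omega> \<in> \<Lambda>" for \<omega>
    using min_pow_nonneg min_pow_le_max_pow ball_ne[OF that] by auto
  have tri0: "0 \<le> tri k e \<alpha> s \<omega>" if "\<omega> \<in> \<Lambda>" for \<omega>
    using that sub \<alpha> s by (intro tri_nonneg) auto
  have I0: "0 \<le> ?I" unfolding cap_integral_eq by (rule Bochner_Integration.integral_nonneg) auto
  have IX: "?I \<le> X"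
    unfolding X_def using \<Lambda> sr by (intro cap_integral_le_sum_max) (simp_all add: s_def)
  have "X \<le> (\<Sum>\<omega>\<in>\<Lambda>. 2 powr (p - 1) * (min_pow e \<alpha> p f \<omega> r + max_osc e \<alpha> p f \<omega> r) * ?V \<omega>)"
    unfolding X_def by (intro sum_mono mult_right_mono max_pow_le ball_ne) auto
  also have "\<dots> = 2 powr (p - 1) * (Y + (\<Sum>\<omega>\<in>\<Lambda>. max_osc e \<alpha> p f \<omega> r * ?V \<omega>))"
    by (simp add: Y_def sum_distrib_left algebra_simps flip: sum.distrib)
  also have "\<dots> \<le> 2 powr (p - 1) * (Y + (C1 * \<delta>) powr p * ?I)"
    using osc by (intro mult_left_mono add_left_mono) (auto simp: r_def s_def)
  also have "\<dots> = 2 powr (p - 1) * Y + (2 powr (p - 1) * (C1 * \<delta>) powr p) * ?I"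
    by (simp add: algebra_simps)
  also have "(2 powr (p - 1) * (C1 * \<delta>) powr p) * ?I \<le> 1 / 4 * X"
    using oscillation_factor_le[OF C1 \<delta>(1,3) p] IX I0 by (intro mult_mono) auto
  finally have XY: "X \<le> (4 / 3 * 2 powr (p - 1)) * Y" by simp
  have compare: "(\<Sum>\<omega>\<in>\<Lambda>. w \<omega> * ?V \<omega>) \<le> upper_const * (\<Sum>\<omega>\<in>\<Lambda>. w \<omega> * tri k e \<alpha> s \<omega>)"
    "lower_const * (\<Sum>\<omega>\<in>\<Lambda>. w \<omega> * tri k e \<alpha> s \<omega>) \<le> (\<Sum>\<omega>\<in>\<Lambda>. w \<omega> * ?V \<omega>)"
    if w: "\<And>\<omega>. \<omega> \<in> \<Lambda> \<Longrightarrow> 0 \<le> w \<omega>" for w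
    unfolding sum_distrib_left mult.left_commute[of _ "w _"]
    using sub by (intro sum_mono mult_left_mono measure_rho_ball[OF _ s d] w; blast)+
  have max0: "0 \<le> max_pow e \<alpha> p f \<omega> r" if "\<omega> \<in> \<Lambda>" for \<omega>
    using min0[OF that] min_max[OF that] by linarith
  have XM: "X \<le> upper_const * M" and MX: "lower_const * M \<le> X"
    unfolding X_def M_def r_def[symmetric] s_def[symmetric] by (intro compare max0; simp)+
  have YM: "Y \<le> upper_const * \<mu>"
    unfolding Y_def \<mu>_def r_def[symmetric] s_def[symmetric] by (intro compare min0)
  have "lower_const * \<mu> \<le> (\<Sum>\<omega>\<in>\<Lambda>. 3 ^ (k + 1) * (min_pow e \<alpha> p f \<omega> r * measure sphere_measure (rho_ball e \<alpha> \<omega> (s / 3))))"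
    unfolding \<mu>_def sum_distrib_left r_def[symmetric] s_def[symmetric]
  proof (rule sum_mono)
    fix \<omega> assume \<omega>: "\<omega> \<in> \<Lambda>"
    then have cap: "\<omega> \<in> cap e \<alpha>" using sub by blast
    have "lower_const * tri k e \<alpha> s \<omega> \<le> lower_const * (3 ^ (k + 1) * tri k e \<alpha> (s / 3) \<omega>)"
      using const_pos tri_third_ge[OF cap \<alpha>(1), of s k] s by (intro mult_left_mono) auto
    also have "\<dots> = 3 ^ (k + 1) * (lower_const * tri k e \<alpha> (s / 3) \<omega>)" by simp
    also have "\<dots> \<le> 3 ^ (k + 1) * measure sphere_measure (rho_ball e \<alpha> \<omega> (s / 3))"
      using s by (intro mult_left_mono measure_rho_ball(2)[OF cap _ _ d]) auto
    finally have "min_pow e \<alpha> p f \<omega> r * (lower_const * tri k e \<alpha> s \<omega>)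
        \<le> min_pow e \<alpha> p f \<omega> r * (3 ^ (k + 1) * measure sphere_measure (rho_ball e \<alpha> \<omega> (s / 3)))"
      using min0[OF \<omega>] by (rule mult_left_mono)
    then show "lower_const * (min_pow e \<alpha> p f \<omega> r * tri k e \<alpha> s \<omega>)
        \<le> 3 ^ (k + 1) * (min_pow e \<alpha> p f \<omega> r * measure sphere_measure (rho_ball e \<alpha> \<omega> (s / 3)))"
      by (simp only: mult.left_commute)
  qed
  also have "\<dots> \<le> 3 ^ (k + 1) * ?I"
    using sum_min_le_cap_integral[OF sep \<alpha>(1) s(1) sr]
    unfolding sum_distrib_left[symmetric] by (intro mult_left_mono) auto
  finally have \<mu>I: "lower_const * \<mu> \<le> 3 ^ (k + 1) * ?I" .
  have \<mu>0: "0 \<le> \<mu>" and \<mu>M: "\<mu> \<le> M"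
    unfolding \<mu>_def M_def r_def[symmetric] s_def[symmetric]
    using min0 min_max tri0 by (auto intro!: sum_nonneg sum_mono mult_right_mono)
  have "?I \<le> upper_const * M" using IX XM by simp
  moreover have "lower_const * M \<le> (4 / 3 * 2 powr (p - 1)) * (upper_const * \<mu>)"
  proof -
    have "(4 / 3 * 2 powr (p - 1)) * Y \<le> (4 / 3 * 2 powr (p - 1)) * (upper_const * \<mu>)"
      by (intro mult_left_mono YM) auto
    with MX XY show ?thesis by linarith
  qed
  ultimately show ?thesis
    unfolding K_def K'_def using const_pos I0 \<mu>0 \<mu>I \<mu>M
    by (intro conjI sandwich_constants) auto
qed

end

theorem corollary1p4:
  fixes d :: nat and \<epsilon> \<beta> p C1 :: real
  assumes "d \<ge> 1" and "CARD('n::finite) = d + 1"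
    and "0 < \<epsilon>" and "\<epsilon> < 1" and "\<beta> \<ge> 1" and "1 \<le> p" and "C1 > 0"
    and C1: "\<forall>(e :: real ^ 'n) \<alpha> (n :: nat) \<delta> \<Lambda> f.
      e \<in> sphere 0 1 \<longrightarrow> 0 < \<alpha> \<longrightarrow> \<alpha> \<le> pi - \<epsilon> \<longrightarrow> n > 0 \<longrightarrow> 0 < \<delta> \<longrightarrow> \<delta> \<le> 1 \<longrightarrow>
      rho_separable e \<alpha> (\<delta> / real n) \<Lambda> \<longrightarrow> f \<in> spherical_polys n \<longrightarrow>
      (\<Sum>\<omega>\<in>\<Lambda>. max_osc e \<alpha> p f \<omega> (\<beta> * \<delta> / real n)
               * measure sphere_measure (rho_ball e \<alpha> \<omega> (\<delta> / real n)))
        \<le> (C1 * \<delta>) powr p * cap_integral e \<alpha> p f"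
  shows "\<exists>K > 0. \<exists>K' > 0. \<forall>(e :: real ^ 'n) \<alpha> (n :: nat) \<delta> \<Lambda>.
      e \<in> sphere 0 1 \<longrightarrow> 0 < \<alpha> \<longrightarrow> \<alpha> \<le> pi - \<epsilon> \<longrightarrow> n > 0 \<longrightarrow> 0 < \<delta> \<longrightarrow> \<delta> \<le> 1 \<longrightarrow>
      \<delta> \<le> 1 / (4 * C1) \<longrightarrow> maximal_rho_separable e \<alpha> (\<delta> / real n) \<Lambda> \<longrightarrow>
      (\<forall>f \<in> spherical_polys n.
        equiv_with K (cap_integral e \<alpha> p f)
          (\<Sum>\<omega>\<in>\<Lambda>. max_pow e \<alpha> p f \<omega> (\<beta> * \<delta> / real n) * tri d e \<alpha> (\<delta> / real n) \<omega>) \<and>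
        equiv_with K'
          (\<Sum>\<omega>\<in>\<Lambda>. max_pow e \<alpha> p f \<omega> (\<beta> * \<delta> / real n) * tri d e \<alpha> (\<delta> / real n) \<omega>)
          (\<Sum>\<omega>\<in>\<Lambda>. min_pow e \<alpha> p f \<omega> (\<beta> * \<delta> / real n) * tri d e \<alpha> (\<delta> / real n) \<omega>))"
proof -
  \<comment> \<open>Concavity gives \<open>sin v \<ge> m v\<close> on \<open>[0, \<pi> - \<epsilon>]\<close> with this slope.\<close>
  define m where "m = sin \<epsilon> / pi"
  have \<epsilon>: "0 < \<epsilon>" "\<epsilon> < pi" using assms(3,4) pi_gt3 by auto
  have m: "0 < m" "m \<le> 1"
  proof -
    show "0 < m" using \<epsilon> by (simp add: m_def sin_gt_zero)
    have "sin \<epsilon> \<le> pi" using sin_le_one[of \<epsilon>] pi_gt3 by linarith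
    then show "m \<le> 1" by (simp add: m_def divide_le_eq)
  qed
  have sin_ge: "m * v \<le> sin v" if "0 \<le> v" "v \<le> pi - \<epsilon>" for v
  proof -
    have "m * v = v / pi * sin \<epsilon>" by (simp add: m_def)
    also have "\<dots> \<le> v / (pi - \<epsilon>) * sin \<epsilon>"
      using that \<epsilon> sin_gt_zero[of \<epsilon>] by (intro mult_right_mono divide_left_mono) auto
    also have "\<dots> = v / (pi - \<epsilon>) * sin (pi - \<epsilon>)" by simp
    also have "\<dots> \<le> sin v" using that \<epsilon> by (intro sin_ge_chord) auto
    finally show ?thesis .
  qed
  have geom: "cap_geometry e \<alpha> m" if "norm e = 1" "0 < \<alpha>" "\<alpha> \<le> pi - \<epsilon>" for e :: "real^'n" and \<alpha>
    using that assms(1,2) \<epsilon> m sin_ge by unfold_locales auto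
  \<comment> \<open>The constants depend on \<open>m\<close> and the dimension only, so they can be read off from any one cap.\<close>
  obtain e0 :: "real^'n" where "norm e0 = 1" using vector_choose_size[of 1] by auto
  then interpret base: cap_geometry e0 "pi - \<epsilon>" m using \<epsilon> by (intro geom) auto
  let ?q = "4 / 3 * 2 powr (p - 1) :: real"
  let ?K = "base.upper_const + ?q * base.upper_const * 3 ^ (d + 1) / base.lower_const\<^sup>2"
  let ?K' = "1 + ?q * base.upper_const / base.lower_const"
  have K: "0 < ?K" "0 < ?K'" using base.const_pos by (auto intro!: add_pos_nonneg)
  show ?thesis
  proof (rule exI[of _ ?K], rule conjI[OF K(1)], rule exI[of _ ?K'], rule conjI[OF K(2)],
      intro allI impI ballI)
    fix e :: "real^'n" and \<alpha> :: real and n :: nat and \<delta> :: real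
      and \<Lambda> :: "(real^'n) set" and f :: "real^'n \<Rightarrow> real"
    assume asm: "e \<in> sphere 0 1" "0 < \<alpha>" "\<alpha> \<le> pi - \<epsilon>" "n > 0" "0 < \<delta>" "\<delta> \<le> 1"
      "\<delta> \<le> 1 / (4 * C1)" "maximal_rho_separable e \<alpha> (\<delta> / real n) \<Lambda>" "f \<in> spherical_polys n"
    interpret cap_geometry e \<alpha> m using asm by (intro geom) auto
    have sep: "rho_separable e \<alpha> (\<delta> / real n) \<Lambda>" using asm(8) by (simp add: maximal_rho_separable_def)
    show "equiv_with ?K (cap_integral e \<alpha> p f)
          (\<Sum>\<omega>\<in>\<Lambda>. max_pow e \<alpha> p f \<omega> (\<beta> * \<delta> / real n) * tri d e \<alpha> (\<delta> / real n) \<omega>) \<and>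
        equiv_with ?K'
          (\<Sum>\<omega>\<in>\<Lambda>. max_pow e \<alpha> p f \<omega> (\<beta> * \<delta> / real n) * tri d e \<alpha> (\<delta> / real n) \<omega>)
          (\<Sum>\<omega>\<in>\<Lambda>. min_pow e \<alpha> p f \<omega> (\<beta> * \<delta> / real n) * tri d e \<alpha> (\<delta> / real n) \<omega>)"
      by (rule marcinkiewicz_zygmund[OF assms(2,6,5,7) asm(5,6,7,4,8)
            continuous_on_spherical_poly[OF asm(9)] C1[rule_format, OF asm(1-6) sep asm(9)]])
  qed
qed

end
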